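(* Let $\sigma>0$, let $\mu$ be the isotropic Gaussian distribution $\mathcal N(0,\sigma^2 I)$ on $\mathbb R^d$, let $f\in\mathcal F$, $g=f\star\mu$, $x\in\mathbb R^d$, $y^{(0)}=g(x)_c$ and $y^{(1)}=\nabla g_c(x)$. Let $q,m_1$ be real numbers with $\frac12<q\le y^{(0)}$ and $m_1\ge\sigma\|y^{(1)}\|_2$, and let $(r,w_1,w_2)$ with $r>0$ and $-\infty\le w_2<w_1<\infty$ be a solution of the system $$\Phi(w_1-r)-\Phi(w_2-r)=\tfrac12,\qquad \Phi(w_1)-\Phi(w_2)=q,\qquad \tfrac{1}{\sqrt{2\pi}}e^{-w_1^2/2}-\tfrac{1}{\sqrt{2\pi}}e^{-w_2^2/2}=m_1 .$$ Then $R=\sigma r$ is a certified $\ell_2$ norm radius, i.e. every $\delta\in\mathbb R^d$ with $\|\delta\|_2<R$ lies in $\mathbf{SR}_L(x)$; and if $q=y^{(0)}$ and $m_1=\sigma\|y^{(1)}\|_2$, then $R$ is exactly the first-order certified $\ell_2$ norm radius, i.e. the largest number with this property.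
   Context: $\mathcal Y$ is a finite set of at least two classes, $\Delta^{\mathcal Y}$ the probability simplex over $\mathcal Y$, $\mathcal F$ the set of all measurable $f:\mathbb R^d\to\Delta^{\mathcal Y}$. $(f\star\mu)(x)=\int_{\mathbb R^d}f(x+z)\mu(z)\,dz$ and $\mathcal G^\mu_{\mathcal F}=\{f\star\mu:f\in\mathcal F\}$. A class $c\in\mathcal Y$ (the class predicted at $x$) is fixed, $h(z)_c$ denotes the $c$-th component of $h(z)$ and $h_c$ the corresponding scalar function. The first-order lower-bound probability function is $$\mathbf p_x(z)=\min\{h(z)_c:\ h\in\mathcal G^\mu_{\mathcal F},\ h(x)_c=y^{(0)},\ \nabla h_c(x)=y^{(1)}\},$$ and the first-order certified safety region is $\mathbf{SR}_L(x)=\{\delta\in\mathbb R^d:\ \mathbf p_x(x+\delta)>\tfrac12\}$. $\Phi$ is the standard normal CDF, with $\Phi(-\infty)=0$ and $e^{-(-\infty)^2/2}=0$. *)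

theory Defs
  imports "HOL-Probability.Probability"
begin

definition prob_simplex :: "(real ^ 'y::finite) set" where
  "prob_simplex = {p. (\<forall>c. 0 \<le> p $ c) \<and> (\<Sum>c\<in>UNIV. p $ c) = 1}"

definition classifiers :: "(real ^ 'd::finite \<Rightarrow> real ^ 'y::finite) set" where
  "classifiers = {f. f \<in> borel_measurable borel \<and> (\<forall>x. f x \<in> prob_simplex)}"

text \<open>The second argument is a density with respect to Lebesgue measure; as usual in randomized
  smoothing, the integrand has \<open>x + z\<close>, where a convolution in the strict sense has \<open>x - z\<close>.\<close>

definition smoothing ::
  "(real ^ 'd::finite \<Rightarrow> real ^ 'y::finite) \<Rightarrow> (real ^ 'd \<Rightarrow> real) \<Rightarrow> real ^ 'd \<Rightarrow> real ^ 'y" where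
  "smoothing f \<mu> x = (\<integral>z. \<mu> z *\<^sub>R f (x + z) \<partial>lborel)"

definition smoothed_classifiers ::
  "(real ^ 'd::finite \<Rightarrow> real) \<Rightarrow> (real ^ 'd \<Rightarrow> real ^ 'y::finite) set" where
  "smoothed_classifiers \<mu> = {smoothing f \<mu> | f. f \<in> classifiers}"

definition gaussian_density :: "real \<Rightarrow> real ^ 'd::finite \<Rightarrow> real" where
  "gaussian_density \<sigma> z =
     exp (- (norm z)\<^sup>2 / (2 * \<sigma>\<^sup>2)) / sqrt (2 * pi * \<sigma>\<^sup>2) ^ CARD('d)"

text \<open>The minimum over an infinite set of reals is written with \<open>LEAST\<close>, so that its value is
  meaningful only if the minimum is attained; it is not replaced by an infimum.
  \<open>GDERIV h x :> D\<close> says that \<open>h\<close> is differentiable at \<open>x\<close> with gradient \<open>D\<close>.\<close>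

definition lower_bound_prob ::
  "(real ^ 'd::finite \<Rightarrow> real) \<Rightarrow> 'y::finite \<Rightarrow> real ^ 'd \<Rightarrow> real \<Rightarrow> real ^ 'd \<Rightarrow> real ^ 'd \<Rightarrow> real" where
  "lower_bound_prob \<mu> c x y0 y1 z =
     (LEAST v. v \<in> {h z $ c | h :: real ^ 'd \<Rightarrow> real ^ 'y.
        h \<in> smoothed_classifiers \<mu> \<and> h x $ c = y0 \<and> GDERIV (\<lambda>u. h u $ c) x :> y1})"

definition safety_region ::
  "(real ^ 'd::finite \<Rightarrow> real) \<Rightarrow> 'y::finite \<Rightarrow> real ^ 'd \<Rightarrow> real \<Rightarrow> real ^ 'd \<Rightarrow> (real ^ 'd) set" where
  "safety_region \<mu> c x y0 y1 = {\<delta>. lower_bound_prob \<mu> c x y0 y1 (x + \<delta>) > 1 / 2}"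

definition certified_radius :: "(real ^ 'd::finite) set \<Rightarrow> real \<Rightarrow> bool" where
  "certified_radius S \<rho> \<longleftrightarrow> (\<forall>\<delta>. norm \<delta> < \<rho> \<longrightarrow> \<delta> \<in> S)"

text \<open>The standard normal distribution function and density, extended to \<open>\<plusminus>\<infinity>\<close> by their limits.\<close>

definition Phi :: "ereal \<Rightarrow> real" where
  "Phi w = (case w of ereal t \<Rightarrow> cdf std_normal_distribution t | PInfty \<Rightarrow> 1 | MInfty \<Rightarrow> 0)"

definition phi :: "ereal \<Rightarrow> real" where
  "phi w = (case w of ereal t \<Rightarrow> exp (- t\<^sup>2 / 2) / sqrt (2 * pi) | PInfty \<Rightarrow> 0 | MInfty \<Rightarrow> 0)"

end

theory Submission
  imports Defs
begin

text \<open>Write \<open>N\<close> for the Gaussian measure. A Cameron--Martin shift turns \<open>h(x + \<delta>)\<^sub>c\<close> into the integral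
  of \<open>F(z) = f(x + z)\<^sub>c\<close> against the exponential tilt of \<open>N\<close>, and differentiating the tilt turns the
  gradient constraint into a constraint on the first moment of \<open>F\<close>. The lower bound is thus the
  minimum of a linear functional over functions with values in \<open>[0, 1]\<close> and prescribed integrals.
  The tilt in direction \<open>k\<close> is a convex function of \<open>z \<bullet> k\<close>, so comparing it with a chord
  (Neyman--Pearson) shows that the indicator of the slab \<open>w2 < z \<bullet> k \<le> w1\<close> is extremal. Its tilted
  mass \<open>Phi (w1 - s) - Phi (w2 - s)\<close> decreases strictly in \<open>s\<close> and equals \<open>1/2\<close> at \<open>s = r\<close>; the slab
  with \<open>k\<close> pointing against the gradient is feasible if both inequalities in the hypotheses are
  equalities, which gives sharpness.\<close>

section \<open>Attained minima over test functions\<close>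

lemma (in prob_space) integral_abs_le_sqrt:
  fixes f :: "'a \<Rightarrow> real"
  assumes [measurable]: "f \<in> borel_measurable M" and b: "\<And>x. \<bar>f x\<bar> \<le> B"
  shows "(\<integral>x. \<bar>f x\<bar> \<partial>M)\<^sup>2 \<le> (\<integral>x. (f x)\<^sup>2 \<partial>M)"
proof -
  have i1: "integrable M (\<lambda>x. \<bar>f x\<bar>)"
    by (rule integrable_const_bound[where B=B]) (auto simp: b)
  have i2: "integrable M (\<lambda>x. (f x)\<^sup>2)"
  proof (rule integrable_const_bound[where B="B\<^sup>2"])
    show "AE x in M. norm ((f x)\<^sup>2) \<le> B\<^sup>2"
      using power_mono[OF b, of _ 2] by simp
  qed auto
  have "variance (\<lambda>x. \<bar>f x\<bar>) = (\<integral>x. (f x)\<^sup>2 \<partial>M) - (\<integral>x. \<bar>f x\<bar> \<partial>M)\<^sup>2"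
    using variance_eq[OF i1] i2 by simp
  then show ?thesis
    using variance_positive[of "\<lambda>x. \<bar>f x\<bar>"] by linarith
qed

definition test_functions :: "'a measure \<Rightarrow> ('i \<Rightarrow> 'a \<Rightarrow> real) \<Rightarrow> ('i \<Rightarrow> real) \<Rightarrow> ('a \<Rightarrow> real) set" where
  "test_functions M h m = {F \<in> borel_measurable M. (\<forall>x. 0 \<le> F x \<and> F x \<le> 1) \<and>
     (\<forall>i. (\<integral>x. F x * h i x \<partial>M) = m i)}"

lemma integrable_mult_test:
  fixes g :: "'a \<Rightarrow> real"
  assumes "integrable M g" and [measurable]: "F \<in> borel_measurable M" and "\<And>x. 0 \<le> F x \<and> F x \<le> 1"
  shows "integrable M (\<lambda>x. F x * g x)"
proof (rule Bochner_Integration.integrable_bound[OF assms(1)])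
  show "(\<lambda>x. F x * g x) \<in> borel_measurable M"
    using assms(1) by measurable
  have "\<bar>F x\<bar> * \<bar>g x\<bar> \<le> \<bar>g x\<bar>" for x
    using assms(3)[of x] by (intro mult_left_le_one_le) auto
  then show "AE x in M. norm (F x * g x) \<le> norm (g x)"
    by (simp add: abs_mult)
qed

lemma test_functions_midpoint:
  assumes F: "F \<in> test_functions M h m" and G: "G \<in> test_functions M h m" and h: "\<And>i. integrable M (h i)"
  shows "(\<lambda>x. (F x + G x) / 2) \<in> test_functions M h m"
proof -
  have [measurable]: "F \<in> borel_measurable M" "G \<in> borel_measurable M"
    and b: "0 \<le> F x \<and> F x \<le> 1" "0 \<le> G x \<and> G x \<le> 1" for x
    using F G by (auto simp: test_functions_def)
  have "0 \<le> (F x + G x) / 2 \<and> (F x + G x) / 2 \<le> 1" for x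
    using b[of x] by auto
  moreover have "(\<integral>x. (F x + G x) / 2 * h i x \<partial>M) = m i" for i
  proof -
    have "(\<integral>x. (F x + G x) / 2 * h i x \<partial>M) = (\<integral>x. (F x * h i x + G x * h i x) / 2 \<partial>M)"
      by (intro Bochner_Integration.integral_cong) (auto simp: field_simps)
    also have "\<dots> = ((\<integral>x. F x * h i x \<partial>M) + (\<integral>x. G x * h i x \<partial>M)) / 2"
      using integrable_mult_test[OF h, of F i] integrable_mult_test[OF h, of G i] b
      by (subst integral_divide_zero, subst Bochner_Integration.integral_add) auto
    finally show ?thesis using F G by (simp add: test_functions_def)
  qed
  ultimately show ?thesis by (simp add: test_functions_def)
qed

text \<open>Weak compactness of the set of test functions is replaced by a Hilbert space argument:
  elements of almost minimal norm in the nested sublevel sets form an \<open>L\<^sup>2\<close> Cauchy sequence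
  by the parallelogram law.\<close>

lemma (in prob_space) test_functions_attain_min:
  fixes h :: "'i \<Rightarrow> 'a \<Rightarrow> real"
  assumes h: "\<And>i. integrable M (h i)" and g: "integrable M g"
    and ne: "test_functions M h m \<noteq> {}"
  shows "\<exists>F\<in>test_functions M h m. \<forall>G\<in>test_functions M h m. (\<integral>x. F x * g x \<partial>M) \<le> (\<integral>x. G x * g x \<partial>M)"
proof -
  define K where "K = test_functions M h m"
  define L where "L F = (\<integral>x. F x * g x \<partial>M)" for F :: "'a \<Rightarrow> real"
  define Q where "Q F = (\<integral>x. (F x)\<^sup>2 \<partial>M)" for F :: "'a \<Rightarrow> real"
  have KD [measurable_dest]: "F \<in> borel_measurable M" if "F \<in> K" for F
    using that by (auto simp: K_def test_functions_def)
  have Kb: "0 \<le> F x \<and> F x \<le> 1" if "F \<in> K" for F x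
    using that by (auto simp: K_def test_functions_def)
  have int_test: "integrable M (\<lambda>x. F x * u x)" if "F \<in> K" "integrable M u" for F u
    using integrable_mult_test[OF that(2) KD[OF that(1)] Kb[OF that(1)]] .
  have int_sq: "integrable M (\<lambda>x. (F x)\<^sup>2)" if "F \<in> K" for F
    using KD[OF that] Kb[OF that] by (intro integrable_const_bound[where B=1]) (auto intro!: power_le_one)
  have L_lower: "- (\<integral>x. \<bar>g x\<bar> \<partial>M) \<le> L F" if "F \<in> K" for F
  proof -
    have "(\<integral>x. - \<bar>g x\<bar> \<partial>M) \<le> L F"
      unfolding L_def
    proof (rule integral_mono)
      fix x
      have "\<bar>F x * g x\<bar> \<le> \<bar>g x\<bar>"
        unfolding abs_mult using Kb[OF that, of x] by (intro mult_left_le_one_le) auto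
      then show "- \<bar>g x\<bar> \<le> F x * g x" by linarith
    qed (use g int_test[OF that g] in auto)
    then show ?thesis by simp
  qed
  have Q0: "0 \<le> Q F" for F
    unfolding Q_def by (intro integral_nonneg_AE) auto
  have Q1: "Q F \<le> 1" if "F \<in> K" for F
  proof -
    have "Q F \<le> (\<integral>x. 1 \<partial>M)"
      unfolding Q_def using Kb[OF that] int_sq[OF that]
      by (intro integral_mono) (auto intro!: power_le_one)
    then show ?thesis by (simp add: prob_space)
  qed
  have mid: "(\<lambda>x. (F x + G x) / 2) \<in> K" if "F \<in> K" "G \<in> K" for F G
    using test_functions_midpoint[of F M h m G] h that unfolding K_def by blast
  have L_mid: "L (\<lambda>x. (F x + G x) / 2) = (L F + L G) / 2" if "F \<in> K" "G \<in> K" for F G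
  proof -
    have "L (\<lambda>x. (F x + G x) / 2) = (\<integral>x. (F x * g x + G x * g x) / 2 \<partial>M)"
      unfolding L_def by (intro Bochner_Integration.integral_cong) (auto simp: field_simps)
    also have "\<dots> = (L F + L G) / 2"
      unfolding L_def using int_test[OF that(1) g] int_test[OF that(2) g]
      by (subst integral_divide_zero, subst Bochner_Integration.integral_add) auto
    finally show ?thesis .
  qed
  have parallelogram: "(\<integral>x. (F x - G x)\<^sup>2 \<partial>M) = 2 * Q F + 2 * Q G - 4 * Q (\<lambda>x. (F x + G x) / 2)"
    if "F \<in> K" "G \<in> K" for F G
  proof -
    have "(\<integral>x. (F x - G x)\<^sup>2 \<partial>M) = (\<integral>x. 2 * (F x)\<^sup>2 + 2 * (G x)\<^sup>2 - 4 * ((F x + G x) / 2)\<^sup>2 \<partial>M)"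
      by (intro Bochner_Integration.integral_cong) (auto simp: power2_eq_square field_simps)
    also have "\<dots> = 2 * Q F + 2 * Q G - 4 * Q (\<lambda>x. (F x + G x) / 2)"
      using int_sq[OF that(1)] int_sq[OF that(2)] int_sq[OF mid[OF that]]
      by (subst Bochner_Integration.integral_diff) (auto simp: Q_def)
    finally show ?thesis .
  qed
  define V where "V = Inf (L ` K)"
  have bddL: "bdd_below (L ` K)"
    using L_lower by (auto intro!: bdd_belowI2)
  have neK: "K \<noteq> {}" using ne by (simp add: K_def)
  define Kn where "Kn n = {F \<in> K. L F \<le> V + 1 / Suc n}" for n
  have Kn_ne: "Kn n \<noteq> {}" for n
  proof -
    have "Inf (L ` K) < V + 1 / Suc n" by (simp add: V_def)
    then show ?thesis
      using cInf_lessD[of "L ` K"] neK by (fastforce simp: Kn_def less_imp_le)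
  qed
  have Kn_mono: "Kn n \<subseteq> Kn k" if "k \<le> n" for k n
  proof -
    have "1 / real (Suc n) \<le> 1 / real (Suc k)" using that by (simp add: frac_le)
    then show ?thesis by (auto simp: Kn_def)
  qed
  define s where "s n = Inf (Q ` Kn n)" for n
  have bddQ: "bdd_below (Q ` Kn n)" for n
    using Q0 by (auto intro!: bdd_belowI2[where m=0])
  have s_le: "s n \<le> Q F" if "F \<in> Kn n" for n F
    unfolding s_def using that bddQ by (intro cInf_lower) auto
  have s_mono: "s k \<le> s n" if "k \<le> n" for k n
    unfolding s_def using Kn_ne bddQ Kn_mono[OF that] by (intro cInf_superset_mono) auto
  have s1: "s n \<le> 1" for n
  proof -
    obtain F where "F \<in> Kn n" using Kn_ne by blast
    then show ?thesis using s_le[of F n] Q1[of F] by (auto simp: Kn_def)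
  qed
  have "\<exists>F. F \<in> Kn n \<and> Q F < s n + 1 / Suc n" for n
    using cInf_lessD[of "Q ` Kn n" "s n + 1 / Suc n"] Kn_ne[of n] by (auto simp: s_def)
  then obtain F where F: "\<And>n. F n \<in> Kn n" "\<And>n. Q (F n) < s n + 1 / Suc n" by metis
  have FK: "F n \<in> K" for n using F(1)[of n] by (simp add: Kn_def)
  have "incseq s" using s_mono by (simp add: incseq_def)
  then obtain S where "s \<longlonglongrightarrow> S" using incseq_convergent[of s 1] s1 by blast
  then have "Cauchy s" by (rule LIMSEQ_imp_Cauchy)
  have sq: "(\<integral>x. (F i x - F j x)\<^sup>2 \<partial>M) \<le> 2 * (s i - s N) + 2 * (s j - s N) + 4 / Suc N"
    if "N \<le> i" "N \<le> j" for N i j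
  proof -
    have mem: "F i \<in> Kn N" "F j \<in> Kn N"
      using F(1)[of i] F(1)[of j] Kn_mono that by blast+
    then have "(\<lambda>x. (F i x + F j x) / 2) \<in> Kn N"
      using mid[OF FK FK, of i j] L_mid[OF FK FK, of i j] by (auto simp: Kn_def)
    then have "s N \<le> Q (\<lambda>x. (F i x + F j x) / 2)" by (rule s_le)
    moreover have "Q (F i) \<le> s i + 1 / Suc N" "Q (F j) \<le> s j + 1 / Suc N"
      using F(2)[of i] F(2)[of j] that frac_le[of 1 1 "real (Suc N)" "real (Suc i)"]
        frac_le[of 1 1 "real (Suc N)" "real (Suc j)"] by auto
    moreover have "4 / real (Suc N) = 4 * (1 / Suc N)" by simp
    ultimately show ?thesis unfolding parallelogram[OF FK FK] by argo
  qed
  have "\<exists>N. \<forall>i\<ge>N. \<forall>j\<ge>N. (\<integral>x. norm (F i x - F j x) \<partial>M) < e" if "e > 0" for e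
  proof -
    have "e\<^sup>2 / 8 > 0" using that by simp
    then obtain N1 where N1: "\<And>i j. i \<ge> N1 \<Longrightarrow> j \<ge> N1 \<Longrightarrow> \<bar>s i - s j\<bar> < e\<^sup>2 / 8"
      using \<open>Cauchy s\<close> by (metis CauchyD real_norm_def)
    obtain N2 where N2: "8 / e\<^sup>2 < real N2" using reals_Archimedean2 by blast
    define N where "N = max N1 N2"
    have "8 / e\<^sup>2 < real (Suc N)" using N2 by (simp add: N_def)
    then have N: "4 / real (Suc N) < e\<^sup>2 / 2"
      using that by (simp add: field_simps)
    have "(\<integral>x. norm (F i x - F j x) \<partial>M) < e" if "i \<ge> N" "j \<ge> N" for i j
    proof -
      have "\<bar>F i x - F j x\<bar> \<le> 1" for x
        using Kb[OF FK[of i], of x] Kb[OF FK[of j], of x] by auto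
      then have "(\<integral>x. \<bar>F i x - F j x\<bar> \<partial>M)\<^sup>2 \<le> (\<integral>x. (F i x - F j x)\<^sup>2 \<partial>M)"
        using KD[OF FK[of i]] KD[OF FK[of j]] by (intro integral_abs_le_sqrt[where B=1]) auto
      also have "\<dots> < e\<^sup>2"
      proof -
        have "N1 \<le> N" by (simp add: N_def)
        then have "s i - s N < e\<^sup>2 / 8" "s j - s N < e\<^sup>2 / 8"
          using N1[of i N] N1[of j N] that abs_ge_self[of "s i - s N"] abs_ge_self[of "s j - s N"]
          by linarith+
        then show ?thesis using sq[OF that] N by argo
      qed
      finally show ?thesis using \<open>e > 0\<close> by (auto dest: power_less_imp_less_base)
    qed
    then show ?thesis by blast
  qed
  moreover have "integrable M (F n)" for n
    using int_test[OF FK, of "\<lambda>_. 1" n] by simp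
  ultimately obtain \<theta> where \<theta>: "strict_mono \<theta>" "AE x in M. Cauchy (\<lambda>n. F (\<theta> n) x)"
    using cauchy_L1_AE_cauchy_subseq[of M F] by blast
  define G where "G x = (if Cauchy (\<lambda>n. F (\<theta> n) x) then lim (\<lambda>n. F (\<theta> n) x) else 0)" for x
  have [measurable]: "F n \<in> borel_measurable M" for n using KD[OF FK] .
  have [measurable]: "G \<in> borel_measurable M" unfolding G_def by measurable
  have G_lim: "AE x in M. (\<lambda>n. F (\<theta> n) x) \<longlonglongrightarrow> G x"
    using \<theta>(2) by eventually_elim (auto simp: G_def Cauchy_convergent_iff convergent_LIMSEQ_iff)
  have Gb: "0 \<le> G x \<and> G x \<le> 1" for x
  proof (cases "Cauchy (\<lambda>n. F (\<theta> n) x)")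
    case True
    then have *: "(\<lambda>n. F (\<theta> n) x) \<longlonglongrightarrow> G x"
      by (auto simp: G_def Cauchy_convergent_iff convergent_LIMSEQ_iff)
    show ?thesis
      using LIMSEQ_le_const[OF *, of 0] LIMSEQ_le_const2[OF *, of 1] Kb[OF FK] by blast
  qed (simp add: G_def)
  have lim_int: "(\<lambda>n. \<integral>x. F (\<theta> n) x * u x \<partial>M) \<longlonglongrightarrow> (\<integral>x. G x * u x \<partial>M)" if u: "integrable M u" for u
  proof (rule integral_dominated_convergence[where w="\<lambda>x. \<bar>u x\<bar>"])
    have [measurable]: "u \<in> borel_measurable M" using u by auto
    show "(\<lambda>x. G x * u x) \<in> borel_measurable M" "(\<lambda>x. F (\<theta> n) x * u x) \<in> borel_measurable M" for n
      by measurable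
    show "AE x in M. (\<lambda>n. F (\<theta> n) x * u x) \<longlonglongrightarrow> G x * u x"
      using G_lim by eventually_elim (intro tendsto_intros)
    show "AE x in M. norm (F (\<theta> n) x * u x) \<le> \<bar>u x\<bar>" for n
      using Kb[OF FK[of "\<theta> n"]] by (auto simp: abs_mult intro!: mult_left_le_one_le)
  qed (use u in auto)
  have "(\<integral>x. G x * h i x \<partial>M) = m i" for i
  proof -
    have "(\<lambda>n. \<integral>x. F (\<theta> n) x * h i x \<partial>M) = (\<lambda>n. m i)"
      using FK by (auto simp: K_def test_functions_def)
    then show ?thesis using lim_int[OF h, of i] LIMSEQ_unique tendsto_const by metis
  qed
  then have "G \<in> K" using Gb by (simp add: K_def test_functions_def)
  moreover have "L G \<le> V"
  proof (rule LIMSEQ_le)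
    show "(\<lambda>n. L (F (\<theta> n))) \<longlonglongrightarrow> L G" using lim_int[OF g] by (simp add: L_def)
    have "(\<lambda>n. V + 1 / Suc n) \<longlonglongrightarrow> V + 0"
      by (intro tendsto_add tendsto_const LIMSEQ_Suc[OF lim_1_over_n])
    then show "(\<lambda>n. V + 1 / Suc n) \<longlonglongrightarrow> V" by simp
    show "\<exists>N. \<forall>n\<ge>N. L (F (\<theta> n)) \<le> V + 1 / Suc n"
    proof (intro exI allI impI)
      fix n :: nat
      show "L (F (\<theta> n)) \<le> V + 1 / Suc n"
        using F(1)[of "\<theta> n"] Kn_mono[OF seq_suble[OF \<theta>(1), of n]] by (auto simp: Kn_def)
    qed
  qed
  moreover have "V \<le> L H" if "H \<in> K" for H
    unfolding V_def using that bddL by (intro cInf_lower) auto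
  ultimately show ?thesis
    unfolding K_def L_def by (meson order_trans)
qed

section \<open>The isotropic Gaussian measure\<close>

definition gaussian_measure :: "real \<Rightarrow> (real ^ 'd::finite) measure" where
  "gaussian_measure \<sigma> = density lborel (gaussian_density \<sigma>)"

lemma gaussian_density_nonneg [simp]: "0 \<le> gaussian_density \<sigma> z"
  by (simp add: gaussian_density_def)

lemma borel_measurable_gaussian_density [measurable]: "gaussian_density \<sigma> \<in> borel_measurable borel"
  unfolding gaussian_density_def[abs_def] by measurable

lemma sets_gaussian_measure [simp, measurable_cong]: "sets (gaussian_measure \<sigma>) = sets borel"
  by (simp add: gaussian_measure_def)

lemma space_gaussian_measure [simp]: "space (gaussian_measure \<sigma>) = UNIV"
  by (simp add: gaussian_measure_def)

lemma gaussian_density_eq_prod: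
  fixes z :: "real ^ 'd::finite"
  shows "gaussian_density \<sigma> z = (\<Prod>b\<in>Basis. normal_density 0 \<sigma> (z \<bullet> b))"
proof -
  have "(norm z)\<^sup>2 = (\<Sum>b\<in>Basis. (z \<bullet> b)\<^sup>2)"
    unfolding power2_norm_eq_inner using euclidean_inner[of z z] by (simp add: power2_eq_square)
  then show ?thesis
    by (simp add: gaussian_density_def normal_density_def prod_dividef exp_sum sum_divide_distrib
        sum_negf[symmetric] prod.distrib power_one_over)
qed

lemma nn_integral_gaussian_prod:
  fixes g :: "real ^ 'd::finite \<Rightarrow> real \<Rightarrow> ennreal"
  assumes [measurable]: "\<And>b. b \<in> Basis \<Longrightarrow> g b \<in> borel_measurable borel"
  shows "(\<integral>\<^sup>+z. (\<Prod>b\<in>Basis. g b (z \<bullet> b)) \<partial>gaussian_measure \<sigma>) =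
    (\<Prod>b\<in>Basis. \<integral>\<^sup>+t. g b t \<partial>density lborel (normal_density 0 \<sigma>))"
proof -
  have "(\<integral>\<^sup>+z. (\<Prod>b\<in>Basis. g b (z \<bullet> b)) \<partial>gaussian_measure \<sigma>) =
    (\<integral>\<^sup>+z. (\<Prod>b\<in>Basis. ennreal (normal_density 0 \<sigma> (z \<bullet> b)) * g b (z \<bullet> b)) \<partial>lborel)"
    unfolding gaussian_measure_def
    by (subst nn_integral_density)
       (auto simp: gaussian_density_eq_prod prod_ennreal[symmetric] prod.distrib)
  also have "\<dots> = (\<Prod>b\<in>Basis. \<integral>\<^sup>+t. ennreal (normal_density 0 \<sigma> t) * g b t \<partial>lborel)"
    by (rule nn_integral_lborel_prod) auto
  also have "\<dots> = (\<Prod>b\<in>Basis. \<integral>\<^sup>+t. g b t \<partial>density lborel (normal_density 0 \<sigma>))"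
    by (intro prod.cong refl, subst nn_integral_density) auto
  finally show ?thesis .
qed

lemma emeasure_gaussian_box:
  fixes A :: "real ^ 'd::finite \<Rightarrow> real set"
  assumes [measurable]: "\<And>b. b \<in> Basis \<Longrightarrow> A b \<in> sets borel"
  shows "emeasure (gaussian_measure \<sigma>) {z. \<forall>b\<in>Basis. z \<bullet> b \<in> A b} =
    (\<Prod>b\<in>Basis. emeasure (density lborel (normal_density 0 \<sigma>)) (A b))"
proof -
  have [measurable]: "{z::real^'d. \<forall>b\<in>Basis. z \<bullet> b \<in> A b} \<in> sets borel"
  proof -
    have *: "(\<lambda>z::real^'d. z \<bullet> b) -` A b \<inter> space borel \<in> sets borel" if "b \<in> Basis" for b
      using that by (intro measurable_sets[where A=borel]) auto
    have "{z::real^'d. \<forall>b\<in>Basis. z \<bullet> b \<in> A b} = (\<Inter>b\<in>Basis. (\<lambda>z. z \<bullet> b) -` A b \<inter> space borel)"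
      by auto
    also have "\<dots> \<in> sets borel"
      by (intro sets.finite_INT) (use * in auto)
    finally show ?thesis .
  qed
  have "(\<Prod>b\<in>Basis. indicator (A b) (z \<bullet> b)) =
      (indicator {z::real^'d. \<forall>b\<in>Basis. z \<bullet> b \<in> A b} z :: ennreal)" for z
  proof (cases "\<forall>b\<in>Basis. z \<bullet> b \<in> A b")
    case False
    then obtain b where "b \<in> Basis" "z \<bullet> b \<notin> A b" by blast
    then have "(\<Prod>b\<in>Basis. indicator (A b) (z \<bullet> b)) = (0 :: ennreal)"
      by (intro prod_zero bexI[of _ b]) auto
    then show ?thesis using False by auto
  qed auto
  then have "emeasure (gaussian_measure \<sigma>) {z. \<forall>b\<in>Basis. z \<bullet> b \<in> A b} =
    (\<integral>\<^sup>+z. (\<Prod>b\<in>Basis. indicator (A b) (z \<bullet> b)) \<partial>gaussian_measure \<sigma>)"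
    by (simp del: prod_zero_iff)
  also have "\<dots> = (\<Prod>b\<in>Basis. emeasure (density lborel (normal_density 0 \<sigma>)) (A b))"
    by (subst nn_integral_gaussian_prod) (auto intro!: prod.cong nn_integral_indicator)
  finally show ?thesis .
qed

context
  fixes \<sigma> :: real
  assumes \<sigma>_pos: "0 < \<sigma>"
begin

lemma emeasure_normal_UNIV: "emeasure (density lborel (normal_density 0 \<sigma>)) UNIV = 1"
  using prob_space.emeasure_space_1[OF prob_space_normal_density[OF \<sigma>_pos, of 0]] by simp

lemma prob_space_gaussian: "prob_space (gaussian_measure \<sigma> :: (real ^ 'd::finite) measure)"
  using emeasure_gaussian_box[of "\<lambda>_::real ^ 'd. UNIV" \<sigma>] emeasure_normal_UNIV
  by (intro prob_spaceI) simp

lemma distr_gaussian_coordinate: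
  fixes b :: "real ^ 'd::finite"
  assumes b: "b \<in> Basis"
  shows "distr (gaussian_measure \<sigma>) borel (\<lambda>z. z \<bullet> b) = density lborel (normal_density 0 \<sigma>)"
proof (rule measure_eqI)
  fix A assume "A \<in> sets (distr (gaussian_measure \<sigma>) borel (\<lambda>z. z \<bullet> b))"
  then have A [measurable]: "A \<in> sets borel" by simp
  define B where "B c = (if c = b then A else UNIV)" for c
  have "emeasure (distr (gaussian_measure \<sigma>) borel (\<lambda>z. z \<bullet> b)) A =
      emeasure (gaussian_measure \<sigma>) {z. \<forall>c\<in>Basis. z \<bullet> c \<in> B c}"
    using b by (subst emeasure_distr) (auto intro!: arg_cong2[where f=emeasure] simp: B_def)
  also have "\<dots> = (\<Prod>c\<in>Basis. emeasure (density lborel (normal_density 0 \<sigma>)) (B c))"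
    by (rule emeasure_gaussian_box) (auto simp: B_def)
  also have "\<dots> = (\<Prod>c\<in>Basis. if c = b then emeasure (density lborel (normal_density 0 \<sigma>)) A else 1)"
    by (intro prod.cong) (auto simp: B_def emeasure_normal_UNIV)
  also have "\<dots> = emeasure (density lborel (normal_density 0 \<sigma>)) A"
    using b by (simp add: prod.delta)
  finally show "emeasure (distr (gaussian_measure \<sigma>) borel (\<lambda>z. z \<bullet> b)) A =
    emeasure (density lborel (normal_density 0 \<sigma>)) A" .
qed simp

lemma indep_vars_gaussian_coordinates:
  "prob_space.indep_vars (gaussian_measure \<sigma> :: (real ^ 'd::finite) measure) (\<lambda>_. borel) (\<lambda>b z. z \<bullet> b) Basis"
proof -
  let ?N = "gaussian_measure \<sigma> :: (real ^ 'd::finite) measure"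
  let ?n = "density lborel (normal_density 0 \<sigma>)"
  interpret prob_space ?N by (rule prob_space_gaussian)
  have *: "distr ?N (\<Pi>\<^sub>M b\<in>Basis. borel) (\<lambda>z. \<lambda>b\<in>Basis. z \<bullet> b) = (\<Pi>\<^sub>M b\<in>Basis. ?n)"
  proof (rule product_sigma_finite.PiM_eqI)
    show "product_sigma_finite (\<lambda>_. ?n)"
      using prob_space_normal_density[OF \<sigma>_pos, of 0]
      by (simp add: product_sigma_finite_def prob_space_imp_sigma_finite)
    show "sets (distr ?N (\<Pi>\<^sub>M b\<in>Basis. borel) (\<lambda>z. \<lambda>b\<in>Basis. z \<bullet> b)) = sets (\<Pi>\<^sub>M b\<in>Basis. ?n)"
      by (auto intro!: sets_PiM_cong)
    fix A :: "real ^ 'd \<Rightarrow> real set"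
    assume A: "\<And>i. i \<in> Basis \<Longrightarrow> A i \<in> sets ?n"
    then have "emeasure (distr ?N (\<Pi>\<^sub>M b\<in>Basis. borel) (\<lambda>z. \<lambda>b\<in>Basis. z \<bullet> b)) (Pi\<^sub>E Basis A) =
        emeasure ?N {z. \<forall>b\<in>Basis. z \<bullet> b \<in> A b}"
      by (subst emeasure_distr)
         (auto intro!: arg_cong2[where f=emeasure] sets_PiM_I_finite measurable_restrict simp: PiE_iff)
    also have "\<dots> = (\<Prod>b\<in>Basis. emeasure ?n (A b))"
      using A by (intro emeasure_gaussian_box) auto
    finally show "emeasure (distr ?N (\<Pi>\<^sub>M b\<in>Basis. borel) (\<lambda>z. \<lambda>b\<in>Basis. z \<bullet> b)) (Pi\<^sub>E Basis A) =
      (\<Prod>b\<in>Basis. emeasure ?n (A b))" .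
  qed simp
  show ?thesis
    by (subst indep_vars_iff_distr_eq_PiM)
       (auto simp: * distr_gaussian_coordinate intro!: PiM_cong)
qed

lemma distr_gaussian_inner:
  fixes k :: "real ^ 'd::finite"
  assumes k: "norm k = 1 / \<sigma>"
  shows "distr (gaussian_measure \<sigma>) borel (\<lambda>z. z \<bullet> k) = std_normal_distribution"
proof -
  let ?N = "gaussian_measure \<sigma> :: (real ^ 'd::finite) measure"
  interpret prob_space ?N by (rule prob_space_gaussian)
  define I where "I = {b \<in> Basis. k \<bullet> b \<noteq> 0}"
  have "k \<noteq> 0" using k \<sigma>_pos by auto
  then have "I \<noteq> {}" unfolding I_def using euclidean_all_zero_iff[of k] by blast
  have "indep_vars (\<lambda>_. borel) (\<lambda>b z. z \<bullet> b) I"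
    by (rule indep_vars_subset[OF indep_vars_gaussian_coordinates]) (auto simp: I_def)
  then have ind: "indep_vars (\<lambda>_. borel) (\<lambda>b z. 0 + (k \<bullet> b) * (z \<bullet> b)) I"
    by (rule indep_vars_compose2) auto
  have "distributed ?N lborel (\<lambda>z. z \<bullet> b) (normal_density 0 \<sigma>)" if "b \<in> I" for b
    using that distr_gaussian_coordinate[of b]
    by (auto simp: distributed_def I_def cong: distr_cong)
  then have dist: "distributed ?N lborel (\<lambda>z. 0 + (k \<bullet> b) * (z \<bullet> b)) (normal_density 0 (\<bar>k \<bullet> b\<bar> * \<sigma>))" if "b \<in> I" for b
    using that normal_density_affine[of "\<lambda>z. z \<bullet> b" 0 \<sigma> "k \<bullet> b" 0] \<sigma>_pos by (auto simp: I_def)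
  have "distributed ?N lborel (\<lambda>z. \<Sum>b\<in>I. 0 + (k \<bullet> b) * (z \<bullet> b))
      (normal_density (\<Sum>b\<in>I. 0) (sqrt (\<Sum>b\<in>I. (\<bar>k \<bullet> b\<bar> * \<sigma>)\<^sup>2)))"
    using dist \<sigma>_pos \<open>I \<noteq> {}\<close> ind by (intro sum_indep_normal) (auto simp: I_def)
  moreover have "(\<Sum>b\<in>I. 0 + (k \<bullet> b) * (z \<bullet> b)) = z \<bullet> k" for z
  proof -
    have "z \<bullet> k = (\<Sum>b\<in>Basis. (z \<bullet> b) * (k \<bullet> b))" by (rule euclidean_inner)
    also have "\<dots> = (\<Sum>b\<in>I. (z \<bullet> b) * (k \<bullet> b))"
      by (rule sum.mono_neutral_right) (auto simp: I_def)
    finally show ?thesis by (simp add: mult.commute)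
  qed
  moreover have "(\<Sum>b\<in>I. (\<bar>k \<bullet> b\<bar> * \<sigma>)\<^sup>2) = 1"
  proof -
    have "(\<Sum>b\<in>I. (k \<bullet> b)\<^sup>2) = (\<Sum>b\<in>Basis. (k \<bullet> b)\<^sup>2)"
      by (rule sum.mono_neutral_left) (auto simp: I_def)
    also have "\<dots> = (norm k)\<^sup>2"
      unfolding power2_norm_eq_inner using euclidean_inner[of k k] by (simp add: power2_eq_square)
    finally show ?thesis
      using k \<sigma>_pos by (simp add: power_mult_distrib sum_distrib_right[symmetric] power_divide)
  qed
  ultimately have "distributed ?N lborel (\<lambda>z. z \<bullet> k) std_normal_density" by simp
  then show ?thesis by (auto simp: distributed_def cong: distr_cong)
qed

end

section \<open>Shifts and gradients of Gaussian smoothings\<close>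

lemma abs_exp_minus_tangent_le:
  fixes y :: real
  shows "\<bar>exp y - 1 - y\<bar> \<le> y\<^sup>2 / 2 * exp \<bar>y\<bar>"
proof -
  obtain t where t: "\<bar>t\<bar> \<le> \<bar>y\<bar>" "exp y = (\<Sum>m<2. y ^ m / fact m) + exp t / fact 2 * y ^ 2"
    using Maclaurin_exp_le[of y 2] by blast
  then have "exp y - 1 - y = y\<^sup>2 / 2 * exp t" by (simp add: numeral_2_eq_2)
  then have "\<bar>exp y - 1 - y\<bar> = \<bar>y\<^sup>2 / 2 * exp t\<bar>" by (simp only:)
  also have "\<dots> = y\<^sup>2 / 2 * exp t" by (simp add: abs_mult)
  also have "\<dots> \<le> y\<^sup>2 / 2 * exp \<bar>y\<bar>"
    using t(1) by (intro mult_left_mono) auto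
  finally show ?thesis .
qed

lemma abs_tilt_minus_tangent_le:
  fixes a t :: real
  assumes "0 \<le> a" "a \<le> 1"
  shows "\<bar>exp (a * t - a\<^sup>2 / 2) - 1 - a * t\<bar> \<le> 2 * a\<^sup>2 * (exp (2 * t) + exp (- (2 * t)))"
proof -
  have at: "\<bar>a * t\<bar> \<le> \<bar>t\<bar>" using assms by (simp add: abs_mult mult_left_le_one_le)
  have t1: "1 + \<bar>t\<bar> \<le> exp \<bar>t\<bar>" by (rule exp_ge_add_one_self)
  have t2: "t\<^sup>2 / 2 \<le> exp \<bar>t\<bar>"
    using exp_lower_Taylor_quadratic[of "\<bar>t\<bar>"] by simp
  have e1: "exp \<bar>t\<bar> * exp \<bar>t\<bar> = exp (2 * \<bar>t\<bar>)" by (simp add: exp_add[symmetric])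
  have e2: "exp (2 * \<bar>t\<bar>) \<le> exp (2 * t) + exp (- (2 * t))"
    by (cases "0 \<le> t") (auto simp: abs_if)
  have "\<bar>exp (a * t) - 1 - a * t\<bar> \<le> (a * t)\<^sup>2 / 2 * exp \<bar>a * t\<bar>"
    by (rule abs_exp_minus_tangent_le)
  also have "\<dots> \<le> (a * t)\<^sup>2 / 2 * exp \<bar>t\<bar>"
    using at by (intro mult_left_mono) auto
  also have "\<dots> = a\<^sup>2 * (t\<^sup>2 / 2 * exp \<bar>t\<bar>)"
    by (simp add: power_mult_distrib)
  also have "\<dots> \<le> a\<^sup>2 * exp (2 * \<bar>t\<bar>)"
    using t2 by (intro mult_left_mono) (auto simp: e1[symmetric])
  finally have A: "\<bar>exp (a * t) - 1 - a * t\<bar> \<le> a\<^sup>2 * exp (2 * \<bar>t\<bar>)" .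
  have "1 - a\<^sup>2 / 2 \<le> exp (- (a\<^sup>2 / 2))"
    using exp_ge_add_one_self[of "- (a\<^sup>2 / 2)"] by simp
  moreover have el: "exp (- (a\<^sup>2 / 2)) \<le> 1" by simp
  ultimately have B: "\<bar>exp (- (a\<^sup>2 / 2)) - 1\<bar> \<le> a\<^sup>2 / 2" by linarith
  have C: "\<bar>1 + a * t\<bar> \<le> exp (2 * \<bar>t\<bar>)"
  proof -
    have "\<bar>1 + a * t\<bar> \<le> 1 + \<bar>t\<bar>" using at by linarith
    also have "\<dots> \<le> exp \<bar>t\<bar>" by (rule t1)
    also have "\<dots> \<le> exp (2 * \<bar>t\<bar>)" by simp
    finally show ?thesis .
  qed
  have "exp (a * t - a\<^sup>2 / 2) - 1 - a * t =
      exp (- (a\<^sup>2 / 2)) * (exp (a * t) - 1 - a * t) + (exp (- (a\<^sup>2 / 2)) - 1) * (1 + a * t)"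
  proof -
    have "exp (a * t - a\<^sup>2 / 2) = exp (- (a\<^sup>2 / 2)) * exp (a * t)"
      by (simp add: exp_add[symmetric])
    then show ?thesis by (simp add: algebra_simps)
  qed
  also have "\<bar>\<dots>\<bar> \<le> \<bar>exp (- (a\<^sup>2 / 2))\<bar> * \<bar>exp (a * t) - 1 - a * t\<bar> +
      \<bar>exp (- (a\<^sup>2 / 2)) - 1\<bar> * \<bar>1 + a * t\<bar>"
    unfolding abs_mult[symmetric] by (rule abs_triangle_ineq)
  also have "\<dots> \<le> 1 * (a\<^sup>2 * exp (2 * \<bar>t\<bar>)) + a\<^sup>2 / 2 * exp (2 * \<bar>t\<bar>)"
    by (rule add_mono[OF mult_mono mult_mono[OF B C]]) (use A el in simp_all)
  also have "\<dots> \<le> 2 * a\<^sup>2 * exp (2 * \<bar>t\<bar>)" by simp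
  also have "\<dots> \<le> 2 * a\<^sup>2 * (exp (2 * t) + exp (- (2 * t)))"
    using e2 by (intro mult_left_mono) auto
  finally show ?thesis .
qed

definition tilt :: "real \<Rightarrow> real ^ 'd::finite \<Rightarrow> real ^ 'd \<Rightarrow> real" where
  "tilt \<sigma> d z = exp (z \<bullet> d / \<sigma>\<^sup>2 - (norm d)\<^sup>2 / (2 * \<sigma>\<^sup>2))"

lemma tilt_nonneg [simp]: "0 \<le> tilt \<sigma> d z"
  by (simp add: tilt_def)

lemma borel_measurable_tilt [measurable]: "tilt \<sigma> d \<in> borel_measurable borel"
  unfolding tilt_def[abs_def] by measurable

lemma gaussian_density_shift: "gaussian_density \<sigma> (z - d) = gaussian_density \<sigma> z * tilt \<sigma> d z"
proof -
  have "(norm (z - d))\<^sup>2 = (norm z)\<^sup>2 - 2 * (z \<bullet> d) + (norm d)\<^sup>2"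
    by (simp add: power2_norm_eq_inner algebra_simps inner_commute)
  then have *: "- (norm (z - d))\<^sup>2 / (2 * \<sigma>\<^sup>2) =
      - (norm z)\<^sup>2 / (2 * \<sigma>\<^sup>2) + (z \<bullet> d / \<sigma>\<^sup>2 - (norm d)\<^sup>2 / (2 * \<sigma>\<^sup>2))"
    by (simp add: add_divide_distrib diff_divide_distrib)
  show ?thesis
    unfolding gaussian_density_def tilt_def * exp_add by simp
qed

lemma distr_gaussian_plus:
  fixes d :: "real ^ 'd::finite"
  shows "distr (gaussian_measure \<sigma>) borel ((+) d) = density (gaussian_measure \<sigma>) (tilt \<sigma> d)"
proof -
  have "distr (gaussian_measure \<sigma>) borel ((+) d) =
      distr (density lborel (\<lambda>z. ennreal (gaussian_density \<sigma> (d + z - d)))) borel ((+) d)"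
    by (simp add: gaussian_measure_def)
  also have "\<dots> = density (distr lborel borel ((+) d)) (\<lambda>z. ennreal (gaussian_density \<sigma> (z - d)))"
    by (subst density_distr) auto
  also have "\<dots> = density lborel (\<lambda>z. ennreal (gaussian_density \<sigma> z) * ennreal (tilt \<sigma> d z))"
    by (simp add: lborel_distr_plus gaussian_density_shift ennreal_mult')
  also have "\<dots> = density (gaussian_measure \<sigma>) (tilt \<sigma> d)"
    unfolding gaussian_measure_def by (subst density_density_eq) auto
  finally show ?thesis .
qed

lemma integrable_gaussian_shift:
  fixes u :: "real ^ 'd::finite \<Rightarrow> real"
  assumes [measurable]: "u \<in> borel_measurable borel"
  shows "integrable (gaussian_measure \<sigma>) (\<lambda>z. u (d + z)) \<longleftrightarrow>
    integrable (gaussian_measure \<sigma>) (\<lambda>z. u z * tilt \<sigma> d z)"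
proof -
  have "integrable (gaussian_measure \<sigma>) (\<lambda>z. u (d + z)) \<longleftrightarrow>
      integrable (distr (gaussian_measure \<sigma>) borel ((+) d)) u"
    by (subst integrable_distr_eq) auto
  also have "\<dots> \<longleftrightarrow> integrable (gaussian_measure \<sigma>) (\<lambda>z. u z * tilt \<sigma> d z)"
    unfolding distr_gaussian_plus by (subst integrable_density) (auto simp: mult.commute)
  finally show ?thesis .
qed

lemma integral_gaussian_shift:
  fixes u :: "real ^ 'd::finite \<Rightarrow> real"
  assumes [measurable]: "u \<in> borel_measurable borel"
  shows "(\<integral>z. u (d + z) \<partial>gaussian_measure \<sigma>) = (\<integral>z. u z * tilt \<sigma> d z \<partial>gaussian_measure \<sigma>)"
proof -
  have "(\<integral>z. u (d + z) \<partial>gaussian_measure \<sigma>) = (\<integral>z. u z \<partial>distr (gaussian_measure \<sigma>) borel ((+) d))"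
    by (subst integral_distr) auto
  also have "\<dots> = (\<integral>z. u z * tilt \<sigma> d z \<partial>gaussian_measure \<sigma>)"
    unfolding distr_gaussian_plus by (subst integral_density) (auto simp: mult.commute)
  finally show ?thesis .
qed

context
  fixes \<sigma> :: real
  assumes \<sigma>_pos: "0 < \<sigma>"
begin

interpretation gaussian: prob_space "gaussian_measure \<sigma> :: (real ^ 'd::finite) measure"
  by (rule prob_space_gaussian[OF \<sigma>_pos])

lemma integrable_tilt: "integrable (gaussian_measure \<sigma>) (tilt \<sigma> d)"
  using integrable_gaussian_shift[of "\<lambda>_. 1" \<sigma> d] by simp

lemma integral_tilt:
  fixes d :: "real ^ 'd::finite"
  shows "(\<integral>z. tilt \<sigma> d z \<partial>gaussian_measure \<sigma>) = 1"
  using integral_gaussian_shift[of "\<lambda>_. 1" \<sigma> d]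
    prob_space.prob_space[OF prob_space_gaussian[OF \<sigma>_pos, where 'd='d]] by simp

lemma exp_inner_eq_tilt: "exp (z \<bullet> d) = exp (\<sigma>\<^sup>2 * (norm d)\<^sup>2 / 2) * tilt \<sigma> (\<sigma>\<^sup>2 *\<^sub>R d) z"
proof -
  have "(norm (\<sigma>\<^sup>2 *\<^sub>R d))\<^sup>2 / (2 * \<sigma>\<^sup>2) = \<sigma>\<^sup>2 * (norm d)\<^sup>2 / 2"
    using \<sigma>_pos by (simp add: power_mult_distrib power2_eq_square)
  then show ?thesis
    using \<sigma>_pos by (simp add: tilt_def exp_add[symmetric])
qed

lemma integrable_exp_inner: "integrable (gaussian_measure \<sigma>) (\<lambda>z. exp (z \<bullet> d))"
  unfolding exp_inner_eq_tilt by (intro integrable_mult_right integrable_tilt)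

lemma integral_exp_inner:
  "(\<integral>z. exp (z \<bullet> d) \<partial>gaussian_measure \<sigma>) = exp (\<sigma>\<^sup>2 * (norm d)\<^sup>2 / 2)"
  unfolding exp_inner_eq_tilt by (simp add: integral_tilt)

lemma integrable_inner: "integrable (gaussian_measure \<sigma>) (\<lambda>z. z \<bullet> d)"
proof (rule Bochner_Integration.integrable_bound)
  show "integrable (gaussian_measure \<sigma>) (\<lambda>z. exp (z \<bullet> d) + exp (z \<bullet> (- d)))"
    by (intro Bochner_Integration.integrable_add integrable_exp_inner)
  have "\<bar>t\<bar> \<le> exp t + exp (- t)" for t :: real
    using exp_ge_add_one_self[of t] exp_ge_add_one_self[of "- t"] exp_gt_zero[of t] exp_gt_zero[of "- t"]
    by linarith
  then show "AE z in gaussian_measure \<sigma>. norm (z \<bullet> d) \<le> norm (exp (z \<bullet> d) + exp (z \<bullet> (- d)))"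
    by (simp add: order_trans[OF _ abs_ge_self])
qed auto

lemma integral_tilt_remainder_le:
  fixes d :: "real ^ 'd::finite"
  assumes d: "norm d \<le> \<sigma>"
  shows "(\<integral>z. \<bar>tilt \<sigma> d z - 1 - z \<bullet> d / \<sigma>\<^sup>2\<bar> \<partial>gaussian_measure \<sigma>) \<le> 4 * exp 2 / \<sigma>\<^sup>2 * (norm d)\<^sup>2"
proof (cases "d = 0")
  case True
  then show ?thesis by (simp add: tilt_def)
next
  case False
  define a where "a = norm d / \<sigma>"
  define k where "k = d /\<^sub>R (\<sigma> * norm d)"
  have a: "0 \<le> a" "a \<le> 1" using d \<sigma>_pos by (auto simp: a_def)
  have k: "norm k = 1 / \<sigma>" using False \<sigma>_pos by (simp add: k_def divide_simps)
  have at: "a * (z \<bullet> k) = z \<bullet> d / \<sigma>\<^sup>2" for z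
    using False \<sigma>_pos by (simp add: a_def k_def power2_eq_square divide_simps)
  have aa: "a\<^sup>2 / 2 = (norm d)\<^sup>2 / (2 * \<sigma>\<^sup>2)"
    by (simp add: a_def power_divide)
  have "(\<integral>z. \<bar>tilt \<sigma> d z - 1 - z \<bullet> d / \<sigma>\<^sup>2\<bar> \<partial>gaussian_measure \<sigma>) \<le>
      (\<integral>z. 2 * a\<^sup>2 * (exp (z \<bullet> (2 *\<^sub>R k)) + exp (z \<bullet> (- (2 *\<^sub>R k)))) \<partial>gaussian_measure \<sigma>)"
  proof (rule integral_mono)
    show "integrable (gaussian_measure \<sigma>) (\<lambda>z. \<bar>tilt \<sigma> d z - 1 - z \<bullet> d / \<sigma>\<^sup>2\<bar>)"
      by (intro integrable_abs Bochner_Integration.integrable_diff integrable_tilt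
          integrable_divide_zero integrable_inner) auto
    show "integrable (gaussian_measure \<sigma>) (\<lambda>z. 2 * a\<^sup>2 * (exp (z \<bullet> (2 *\<^sub>R k)) + exp (z \<bullet> (- (2 *\<^sub>R k)))))"
      by (intro integrable_mult_right Bochner_Integration.integrable_add integrable_exp_inner)
    fix z :: "real ^ 'd"
    show "\<bar>tilt \<sigma> d z - 1 - z \<bullet> d / \<sigma>\<^sup>2\<bar> \<le> 2 * a\<^sup>2 * (exp (z \<bullet> (2 *\<^sub>R k)) + exp (z \<bullet> (- (2 *\<^sub>R k))))"
      using abs_tilt_minus_tangent_le[OF a, of "z \<bullet> k"] by (simp add: at aa tilt_def)
  qed
  also have "\<dots> = 2 * a\<^sup>2 * (2 * exp 2)"
  proof -
    have "\<sigma>\<^sup>2 * (norm (2 *\<^sub>R k))\<^sup>2 / 2 = 2"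
      using k \<sigma>_pos by (simp add: power_mult_distrib power_divide)
    then show ?thesis
      by (simp add: integral_exp_inner[of "2 *\<^sub>R k"] integral_exp_inner[of "- (2 *\<^sub>R k)"]
          Bochner_Integration.integral_add[OF integrable_exp_inner integrable_exp_inner] del: inner_scaleR_right inner_minus_right norm_scaleR)
  qed
  also have "\<dots> = 4 * exp 2 / \<sigma>\<^sup>2 * (norm d)\<^sup>2"
    by (simp add: a_def power_divide)
  finally show ?thesis .
qed

lemma has_derivative_gaussian_smoothing:
  fixes F :: "real ^ 'd::finite \<Rightarrow> real"
  assumes [measurable]: "F \<in> borel_measurable borel" and F: "\<And>z. 0 \<le> F z \<and> F z \<le> 1"
  shows "((\<lambda>u. \<integral>z. F (u + z) \<partial>gaussian_measure \<sigma>) has_derivative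
     (\<lambda>v. (\<integral>z. F (x + z) * (z \<bullet> v) \<partial>gaussian_measure \<sigma>) / \<sigma>\<^sup>2)) (at x)"
proof (rule has_derivativeI_sandwich[where e=\<sigma> and H="\<lambda>y. 4 * exp 2 / \<sigma>\<^sup>2 * norm (y - x)"])
  let ?N = "gaussian_measure \<sigma> :: (real ^ 'd) measure"
  have int_F: "integrable ?N (\<lambda>z. F (x + z) * u z)" if "integrable ?N u" for u
  proof (rule Bochner_Integration.integrable_bound[OF that])
    show "(\<lambda>z. F (x + z) * u z) \<in> borel_measurable ?N" using that by measurable
    show "AE z in ?N. norm (F (x + z) * u z) \<le> norm (u z)"
      using F by (auto simp: abs_mult intro!: mult_left_le_one_le)
  qed
  show "bounded_linear (\<lambda>v. (\<integral>z. F (x + z) * (z \<bullet> v) \<partial>?N) / \<sigma>\<^sup>2)"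
    unfolding linear_conv_bounded_linear[symmetric]
  proof (rule linearI)
    fix v w :: "real ^ 'd" and c :: real
    show "(\<integral>z. F (x + z) * (z \<bullet> (v + w)) \<partial>?N) / \<sigma>\<^sup>2 =
      (\<integral>z. F (x + z) * (z \<bullet> v) \<partial>?N) / \<sigma>\<^sup>2 + (\<integral>z. F (x + z) * (z \<bullet> w) \<partial>?N) / \<sigma>\<^sup>2"
      by (simp add: inner_add_right distrib_left add_divide_distrib
          Bochner_Integration.integral_add[OF int_F int_F] integrable_inner)
    have "(\<integral>z. F (x + z) * (z \<bullet> (c *\<^sub>R v)) \<partial>?N) = (\<integral>z. c * (F (x + z) * (z \<bullet> v)) \<partial>?N)"
      by (intro Bochner_Integration.integral_cong) auto
    then show "(\<integral>z. F (x + z) * (z \<bullet> (c *\<^sub>R v)) \<partial>?N) / \<sigma>\<^sup>2 = c *\<^sub>R ((\<integral>z. F (x + z) * (z \<bullet> v) \<partial>?N) / \<sigma>\<^sup>2)"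
      by simp
  qed
  fix y :: "real ^ 'd"
  assume "y \<noteq> x" "dist y x < \<sigma>"
  define d where "d = y - x"
  have d: "d \<noteq> 0" "norm d \<le> \<sigma>"
    using \<open>y \<noteq> x\<close> \<open>dist y x < \<sigma>\<close> by (auto simp: d_def dist_norm)
  have "(\<integral>z. F (y + z) \<partial>?N) = (\<integral>z. F (x + (d + z)) \<partial>?N)"
    by (simp add: d_def algebra_simps)
  also have "\<dots> = (\<integral>z. F (x + z) * tilt \<sigma> d z \<partial>?N)"
    by (rule integral_gaussian_shift) measurable
  finally have "(\<integral>z. F (y + z) \<partial>?N) - (\<integral>z. F (x + z) \<partial>?N) - (\<integral>z. F (x + z) * (z \<bullet> d) \<partial>?N) / \<sigma>\<^sup>2 =
      (\<integral>z. F (x + z) * tilt \<sigma> d z \<partial>?N) - (\<integral>z. F (x + z) * 1 \<partial>?N) - (\<integral>z. F (x + z) * (z \<bullet> d / \<sigma>\<^sup>2) \<partial>?N)"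
    by simp
  also have "\<dots> = (\<integral>z. F (x + z) * tilt \<sigma> d z - F (x + z) * 1 - F (x + z) * (z \<bullet> d / \<sigma>\<^sup>2) \<partial>?N)"
  proof -
    have i: "integrable ?N (\<lambda>z. F (x + z) * tilt \<sigma> d z)" "integrable ?N (\<lambda>z. F (x + z) * 1)"
        "integrable ?N (\<lambda>z. F (x + z) * (z \<bullet> d / \<sigma>\<^sup>2))"
      by (intro int_F integrable_tilt integrable_divide_zero integrable_inner; simp)+
    show ?thesis
      unfolding Bochner_Integration.integral_diff[OF Bochner_Integration.integrable_diff[OF i(1,2)] i(3)]
        Bochner_Integration.integral_diff[OF i(1,2)] ..
  qed
  also have "\<dots> = (\<integral>z. F (x + z) * (tilt \<sigma> d z - 1 - z \<bullet> d / \<sigma>\<^sup>2) \<partial>?N)"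
    by (intro Bochner_Integration.integral_cong) (auto simp: algebra_simps)
  also have "norm \<dots> \<le> (\<integral>z. norm (F (x + z) * (tilt \<sigma> d z - 1 - z \<bullet> d / \<sigma>\<^sup>2)) \<partial>?N)"
    by (rule integral_norm_bound)
  also have "\<dots> \<le> (\<integral>z. \<bar>tilt \<sigma> d z - 1 - z \<bullet> d / \<sigma>\<^sup>2\<bar> \<partial>?N)"
  proof (rule integral_mono)
    have *: "integrable ?N (\<lambda>z. tilt \<sigma> d z - 1 - z \<bullet> d / \<sigma>\<^sup>2)"
      by (intro Bochner_Integration.integrable_diff integrable_tilt integrable_divide_zero integrable_inner) auto
    then show "integrable ?N (\<lambda>z. \<bar>tilt \<sigma> d z - 1 - z \<bullet> d / \<sigma>\<^sup>2\<bar>)" by (rule integrable_abs)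
    show "integrable ?N (\<lambda>z. norm (F (x + z) * (tilt \<sigma> d z - 1 - z \<bullet> d / \<sigma>\<^sup>2)))"
      by (intro integrable_norm int_F *)
    show "norm (F (x + z) * (tilt \<sigma> d z - 1 - z \<bullet> d / \<sigma>\<^sup>2)) \<le> \<bar>tilt \<sigma> d z - 1 - z \<bullet> d / \<sigma>\<^sup>2\<bar>" for z
      unfolding real_norm_def abs_mult using F[of "x + z"] by (intro mult_left_le_one_le) auto
  qed
  also have "\<dots> \<le> 4 * exp 2 / \<sigma>\<^sup>2 * (norm d)\<^sup>2"
    by (rule integral_tilt_remainder_le[OF d(2)])
  finally show "norm ((\<integral>z. F (y + z) \<partial>?N) - (\<integral>z. F (x + z) \<partial>?N) - (\<integral>z. F (x + z) * (z \<bullet> (y - x)) \<partial>?N) / \<sigma>\<^sup>2)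
      / norm (y - x) \<le> 4 * exp 2 / \<sigma>\<^sup>2 * norm (y - x)"
    using d by (simp add: d_def[symmetric] pos_divide_le_eq power2_eq_square mult.assoc)
next
  show "((\<lambda>y. 4 * exp 2 / \<sigma>\<^sup>2 * norm (y - x)) \<longlongrightarrow> 0) (at x)"
    by (rule tendsto_eq_intros refl | simp)+
qed (rule \<sigma>_pos)

lemma gderiv_gaussian_smoothing_iff:
  fixes F :: "real ^ 'd::finite \<Rightarrow> real"
  assumes F: "F \<in> borel_measurable borel" "\<And>z. 0 \<le> F z \<and> F z \<le> 1"
  shows "GDERIV (\<lambda>u. \<integral>z. F (u + z) \<partial>gaussian_measure \<sigma>) x :> D \<longleftrightarrow>
    (\<forall>v. (\<integral>z. F (x + z) * (z \<bullet> v) \<partial>gaussian_measure \<sigma>) = \<sigma>\<^sup>2 * (v \<bullet> D))" (is "?L \<longleftrightarrow> ?R")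
proof
  note der = has_derivative_gaussian_smoothing[OF F, of x]
  { assume ?L
    then have "(\<lambda>v. (\<integral>z. F (x + z) * (z \<bullet> v) \<partial>gaussian_measure \<sigma>) / \<sigma>\<^sup>2) = (\<lambda>v. v \<bullet> D)"
      unfolding gderiv_def using has_derivative_unique[OF der] by blast
    then show ?R using \<sigma>_pos by (auto simp: fun_eq_iff field_simps) }
  { assume ?R
    then show ?L using der \<sigma>_pos by (simp add: gderiv_def) }
qed

end

section \<open>The extremal slab\<close>

interpretation std_normal: real_distribution std_normal_distribution
  by (rule real_dist_normal_dist)

lemma Phi_real [simp]: "Phi (ereal t) = cdf std_normal_distribution t"
  and Phi_MInf [simp]: "Phi (- \<infinity>) = 0"
  and phi_real: "phi (ereal t) = std_normal_density t"
  and phi_MInf [simp]: "phi (- \<infinity>) = 0"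
  by (simp_all add: Phi_def phi_def std_normal_density_def)

lemma Phi_diff:
  assumes "w2 < ereal w1"
  shows "measure std_normal_distribution {t. w2 < ereal t \<and> t \<le> w1} = Phi (ereal w1) - Phi w2"
proof (cases w2)
  case (real v)
  then show ?thesis
    using std_normal.cdf_diff_eq[of v w1] assms by (simp add: greaterThanAtMost_def greaterThan_def atMost_def Int_def)
next
  case MInf
  then show ?thesis by (simp add: cdf_def atMost_def)
qed (use assms in auto)

lemma DERIV_cdf_std_normal:
  "(cdf std_normal_distribution has_real_derivative std_normal_density t) (at t)"
proof -
  let ?a = "t - 1" and ?b = "t + 1"
  have c: "continuous_on S std_normal_density" for S
    unfolding std_normal_density_def[abs_def] by (intro continuous_intros) auto
  have cdf_eq: "cdf std_normal_distribution y = cdf std_normal_distribution ?a + integral {?a..y} std_normal_density"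
    if "?a < y" for y
  proof -
    have "cdf std_normal_distribution y - cdf std_normal_distribution ?a =
        measure std_normal_distribution {?a<..y}"
      using that by (intro std_normal.cdf_diff_eq)
    also have "\<dots> = (\<integral>x. indicator {?a<..y} x \<partial>std_normal_distribution)" by simp
    also have "\<dots> = (\<integral>x. std_normal_density x * indicator {?a<..y} x \<partial>lborel)"
      by (subst integral_density) auto
    also have "\<dots> = (\<integral>x. indicator {?a..y} x *\<^sub>R std_normal_density x \<partial>lborel)"
    proof (rule integral_cong_AE)
      have "AE x in lborel. x \<noteq> ?a" by (rule AE_lborel_singleton)
      then show "AE x in lborel. std_normal_density x * indicator {?a<..y} x =
          indicator {?a..y} x *\<^sub>R std_normal_density x"
        by eventually_elim (auto simp: indicator_def)
    qed auto
    also have "\<dots> = integral {?a..y} std_normal_density"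
      using set_borel_integral_eq_integral(2)[OF borel_integrable_atLeastAtMost'[OF c], of ?a y]
      by (simp add: set_lebesgue_integral_def)
    finally show ?thesis by simp
  qed
  have "((\<lambda>y. integral {?a..y} std_normal_density) has_real_derivative std_normal_density t)
      (at t within {?a..?b})"
    by (rule integral_has_real_derivative) (auto intro: c)
  then have "((\<lambda>y. cdf std_normal_distribution ?a + integral {?a..y} std_normal_density)
      has_real_derivative std_normal_density t) (at t within {?a..?b})"
    by (auto intro!: derivative_eq_intros)
  moreover have "at t within {?a..?b} = at t"
    by (rule at_within_interior) simp
  ultimately have der: "((\<lambda>y. cdf std_normal_distribution ?a + integral {?a..y} std_normal_density)
      has_real_derivative std_normal_density t) (at t)" by simp
  show ?thesis
    by (rule has_field_derivative_transform_within_open[OF der, of "{?a<..}"])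
       (simp_all only: cdf_eq greaterThan_iff open_greaterThan diff_less zero_less_one)
qed

lemma DERIV_Phi_shift:
  assumes "w \<noteq> \<infinity>"
  shows "((\<lambda>s. Phi (w - ereal s)) has_real_derivative - phi (w - ereal s)) (at s)"
proof (cases w)
  case (real v)
  have "((\<lambda>s. cdf std_normal_distribution (v - s)) has_real_derivative std_normal_density (v - s) * (-1)) (at s)"
    by (rule DERIV_chain2[OF DERIV_cdf_std_normal]) (auto intro!: derivative_eq_intros)
  then show ?thesis by (simp add: real phi_real)
qed (use assms in auto)

lemma cdf_std_normal_le_half:
  assumes "w \<le> 0"
  shows "cdf std_normal_distribution w \<le> 1 / 2"
proof -
  have "emeasure std_normal_distribution {..<w} = (\<integral>\<^sup>+x. ennreal (std_normal_density x) * indicator {..<w} x \<partial>lborel)"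
    by (subst emeasure_density) auto
  also have "\<dots> = (\<integral>\<^sup>+x. ennreal (std_normal_density x) * indicator {-w<..} x \<partial>lborel)"
    by (subst nn_integral_real_affine[where c="-1" and t=0])
       (auto simp: std_normal_density_def indicator_def intro!: nn_integral_cong)
  also have "\<dots> = emeasure std_normal_distribution {-w<..}"
    by (subst emeasure_density) auto
  finally have sym: "measure std_normal_distribution {..<w} = measure std_normal_distribution {-w<..}"
    by (simp add: measure_def)
  have "emeasure std_normal_distribution {w} = 0"
  proof -
    have "AE x in lborel. x \<noteq> w" by (rule AE_lborel_singleton)
    then show ?thesis
      by (subst emeasure_density) (auto simp: nn_integral_0_iff_AE elim!: eventually_mono)
  qed
  then have "measure std_normal_distribution {w} = 0" by (simp add: measure_def)
  moreover have "{..w} = {..<w} \<union> {w}" by auto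
  ultimately have "cdf std_normal_distribution w = measure std_normal_distribution {..<w}"
    unfolding cdf_def using std_normal.finite_measure_Union[of "{..<w}" "{w}"] by simp
  moreover have "measure std_normal_distribution ({..<w} \<union> {-w<..}) =
      measure std_normal_distribution {..<w} + measure std_normal_distribution {-w<..}"
    using assms by (intro std_normal.finite_measure_Union) auto
  moreover have "measure std_normal_distribution ({..<w} \<union> {-w<..}) \<le> 1"
    by (rule std_normal.prob_le_1)
  ultimately show ?thesis using sym by linarith
qed

lemma std_normal_density_le_iff: "std_normal_density s \<le> std_normal_density t \<longleftrightarrow> t\<^sup>2 \<le> s\<^sup>2"
proof -
  have "0 < 1 / sqrt (2 * pi)" by simp
  from mult_le_cancel_left_pos[OF this] show ?thesis
    unfolding std_normal_density_def by simp
qed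

lemma std_normal_density_less_iff: "std_normal_density s < std_normal_density t \<longleftrightarrow> t\<^sup>2 < s\<^sup>2"
  by (simp add: std_normal_density_le_iff linorder_not_le[symmetric])

lemma phi_shift_less:
  assumes w: "w2 < ereal w1" and phi: "phi w2 \<le> phi (ereal w1)" and "0 < s"
  shows "phi (w2 - ereal s) < phi (ereal w1 - ereal s)"
proof (cases w2)
  case (real v)
  have "0 \<le> (v - w1) * (v + w1)"
    using phi by (simp add: real phi_real std_normal_density_le_iff power2_eq_square algebra_simps)
  moreover have "v < w1" using w real by simp
  ultimately have "v + w1 \<le> 0" by (simp add: zero_le_mult_iff)
  then have "0 < (w1 - v) * (2 * s - (v + w1))"
    using \<open>v < w1\<close> \<open>0 < s\<close> by (intro mult_pos_pos) auto
  then show ?thesis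
    by (simp add: real phi_real std_normal_density_less_iff power2_eq_square algebra_simps)
next
  case MInf
  then show ?thesis by (simp add: phi_real normal_density_pos)
qed (use w in auto)

lemma Phi_diff_strict_decreasing:
  assumes w: "w2 < ereal w1" and phi: "phi w2 \<le> phi (ereal w1)" and "0 \<le> s" "s < r"
  shows "Phi (ereal w1 - ereal r) - Phi (w2 - ereal r) < Phi (ereal w1 - ereal s) - Phi (w2 - ereal s)"
proof -
  let ?G = "\<lambda>s. Phi (ereal w1 - ereal s) - Phi (w2 - ereal s)"
  have der: "(?G has_real_derivative - phi (ereal w1 - ereal u) - - phi (w2 - ereal u)) (at u)" for u
    using w by (intro DERIV_diff DERIV_Phi_shift) auto
  show ?thesis
  proof (rule DERIV_neg_imp_decreasing_open[OF \<open>s < r\<close>, of ?G])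
    fix u assume "s < u" "u < r"
    then show "\<exists>y. (?G has_real_derivative y) (at u) \<and> y < 0"
      using der[of u] phi_shift_less[OF w phi, of u] \<open>0 \<le> s\<close> by (intro exI conjI) auto
  next
    show "continuous_on {s..r} ?G"
      by (rule DERIV_continuous_on) (rule has_field_derivative_at_within[OF der])
  qed
qed

text \<open>The Lagrange multipliers of the Neyman--Pearson argument are the intercept and the slope of
  the chord of the exponential over the interval \<open>(w2, w1]\<close>.\<close>

lemma exp_chord:
  fixes s w1 :: real
  assumes "0 \<le> s" and w2: "w2 \<le> 0" "w2 < ereal w1" "0 \<le> w1"
  obtains a b where "0 \<le> a" "0 \<le> b"
    "\<And>t. w2 < ereal t \<Longrightarrow> t \<le> w1 \<Longrightarrow> exp (s * t - C) \<le> a + b * t"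
    "\<And>t. ereal t \<le> w2 \<or> w1 < t \<Longrightarrow> a + b * t \<le> exp (s * t - C)"
proof (cases w2)
  case (real v)
  define p where "p t = exp (s * t - C)" for t
  have cv: "p y * (z - x) \<le> (z - y) * p x + (y - x) * p z" if "x \<le> y" "y \<le> z" "x < z" for x y z
  proof -
    have conv: "convex_on UNIV p"
    proof (rule f''_ge0_imp_convex)
      show "(p has_real_derivative s * p t) (at t)" for t
        unfolding p_def by (auto intro!: derivative_eq_intros)
      show "((\<lambda>t. s * p t) has_real_derivative s * (s * p t)) (at t)" for t
        unfolding p_def by (auto intro!: derivative_eq_intros)
      show "0 \<le> s * (s * p t)" for t using \<open>0 \<le> s\<close> by (simp add: p_def)
    qed auto
    define l where "l = (y - x) / (z - x)"
    have l: "0 \<le> l" "l \<le> 1" "l * (z - x) = y - x" using that by (auto simp: l_def)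
    then have "y = (1 - l) *\<^sub>R x + l *\<^sub>R z" by (simp add: algebra_simps)
    then have "p y \<le> (1 - l) * p x + l * p z"
      using convex_onD[OF conv l(1,2), of x z] by simp
    then have "p y * (z - x) \<le> ((1 - l) * p x + l * p z) * (z - x)"
      using that by (intro mult_right_mono) auto
    also have "\<dots> = (z - x - l * (z - x)) * p x + l * (z - x) * p z"
      by (simp add: algebra_simps)
    finally show ?thesis by (simp add: l(3))
  qed
  have v: "v < w1" "v \<le> 0" using w2 real by auto
  define b where "b = (p w1 - p v) / (w1 - v)"
  define a where "a = p v - b * v"
  have b: "b * (w1 - v) = p w1 - p v" using v by (simp add: b_def)
  have "p v \<le> p w1"
    using \<open>0 \<le> s\<close> v by (simp add: p_def mult_left_mono)
  then have b0: "0 \<le> b" using v by (simp add: b_def)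
  have "b * v \<le> 0" using b0 v by (simp add: mult_nonneg_nonpos)
  moreover have "0 < p v" by (simp add: p_def)
  ultimately have a0: "0 \<le> a" by (simp add: a_def)
  have line: "(a + b * t) * (w1 - v) = (w1 - t) * p v + (t - v) * p w1" for t
  proof -
    have "(a + b * t) * (w1 - v) = p v * (w1 - v) + (b * (w1 - v)) * (t - v)"
      by (simp add: a_def algebra_simps)
    then show ?thesis unfolding b by (simp add: algebra_simps)
  qed
  show ?thesis
  proof (rule that[OF a0 b0])
    fix t assume "w2 < ereal t" "t \<le> w1"
    then have "p t * (w1 - v) \<le> (a + b * t) * (w1 - v)"
      unfolding line using cv[of v t w1] v real by auto
    then show "exp (s * t - C) \<le> a + b * t" using v by (simp add: p_def)
  next
    fix t assume "ereal t \<le> w2 \<or> w1 < t"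
    then have "(a + b * t) * (w1 - v) \<le> p t * (w1 - v)"
      unfolding line using cv[of t v w1] cv[of v w1 t] v real by (auto simp: algebra_simps)
    then show "a + b * t \<le> exp (s * t - C)" using v by (simp add: p_def)
  qed
next
  case MInf
  show ?thesis
    by (rule that[of "exp (s * w1 - C)" 0]) (use MInf \<open>0 \<le> s\<close> in \<open>auto intro: mult_left_mono\<close>)
qed (use w2 in auto)

definition slab :: "ereal \<Rightarrow> real \<Rightarrow> real ^ 'd::finite \<Rightarrow> real ^ 'd \<Rightarrow> real" where
  "slab w2 w1 k z = (if w2 < ereal (z \<bullet> k) \<and> z \<bullet> k \<le> w1 then 1 else 0)"

lemma borel_measurable_slab [measurable]: "slab w2 w1 k \<in> borel_measurable borel"
  unfolding slab_def[abs_def] by measurable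

lemma slab_bounds: "0 \<le> slab w2 w1 k z \<and> slab w2 w1 k z \<le> 1"
  by (simp add: slab_def)

context
  fixes \<sigma> :: real and k :: "real ^ 'd::finite" and w2 :: ereal and w1 :: real
  assumes \<sigma>_pos: "0 < \<sigma>" and k: "norm k = 1 / \<sigma>" and w: "w2 < ereal w1"
begin

lemma integral_slab_shift:
  "(\<integral>z. slab w2 w1 k (u + z) \<partial>gaussian_measure \<sigma>) =
    Phi (ereal w1 - ereal (u \<bullet> k)) - Phi (w2 - ereal (u \<bullet> k))"
proof -
  define A where "A = {t. w2 - ereal (u \<bullet> k) < ereal t \<and> t \<le> w1 - u \<bullet> k}"
  have [measurable]: "A \<in> sets borel" unfolding A_def by measurable
  have "slab w2 w1 k (u + z) = indicator A (z \<bullet> k)" for z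
  proof -
    have "w2 < ereal (u \<bullet> k + z \<bullet> k) \<longleftrightarrow> w2 - ereal (u \<bullet> k) < ereal (z \<bullet> k)"
      by (cases w2) auto
    then show ?thesis by (auto simp: slab_def A_def inner_add_left indicator_def)
  qed
  then have "(\<integral>z. slab w2 w1 k (u + z) \<partial>gaussian_measure \<sigma>) =
      (\<integral>t. indicator A t \<partial>distr (gaussian_measure \<sigma>) borel (\<lambda>z. z \<bullet> k))"
    by (subst integral_distr) auto
  also have "\<dots> = measure std_normal_distribution A"
    by (simp add: distr_gaussian_inner[OF \<sigma>_pos k])
  also have "\<dots> = Phi (ereal (w1 - u \<bullet> k)) - Phi (w2 - ereal (u \<bullet> k))"
    unfolding A_def using w by (intro Phi_diff) (cases w2; auto)
  finally show ?thesis by simp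
qed

lemma integral_slab: "(\<integral>z. slab w2 w1 k z \<partial>gaussian_measure \<sigma>) = Phi (ereal w1) - Phi w2"
  using integral_slab_shift[of 0] by (simp add: zero_ereal_def[symmetric])

lemma integral_slab_tilt:
  "(\<integral>z. slab w2 w1 k z * tilt \<sigma> ((s * \<sigma>\<^sup>2) *\<^sub>R k) z \<partial>gaussian_measure \<sigma>) =
    Phi (ereal w1 - ereal s) - Phi (w2 - ereal s)"
proof -
  have "((s * \<sigma>\<^sup>2) *\<^sub>R k) \<bullet> k = s * \<sigma>\<^sup>2 * (norm k)\<^sup>2"
    by (simp add: power2_norm_eq_inner)
  also have "\<dots> = s"
    using k \<sigma>_pos by (simp add: power_divide)
  finally show ?thesis
    using integral_slab_shift[of "(s * \<sigma>\<^sup>2) *\<^sub>R k"]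
      integral_gaussian_shift[of "slab w2 w1 k" \<sigma> "(s * \<sigma>\<^sup>2) *\<^sub>R k"] by (simp only: borel_measurable_slab)
qed

lemma integral_slab_inner:
  "(\<integral>z. slab w2 w1 k z * (z \<bullet> v) \<partial>gaussian_measure \<sigma>) = \<sigma>\<^sup>2 * (phi w2 - phi (ereal w1)) * (v \<bullet> k)"
proof -
  have "w2 \<noteq> \<infinity>" using w by auto
  then have der: "DERIV (\<lambda>s. Phi (ereal w1 - ereal s) - Phi (w2 - ereal s)) 0 :> phi w2 - phi (ereal w1)"
    using DERIV_diff[OF DERIV_Phi_shift[of "ereal w1" 0] DERIV_Phi_shift[of w2 0]]
    by (simp add: zero_ereal_def[symmetric])
  have "GDERIV (\<lambda>u. u \<bullet> k) 0 :> k"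
    unfolding gderiv_def by (auto intro!: derivative_eq_intros)
  then have "GDERIV (\<lambda>u. \<integral>z. slab w2 w1 k (u + z) \<partial>gaussian_measure \<sigma>) 0 :> (phi w2 - phi (ereal w1)) *\<^sub>R k"
    unfolding integral_slab_shift by (rule GDERIV_DERIV_compose) (use der in simp)
  then show ?thesis
    unfolding gderiv_gaussian_smoothing_iff[OF \<sigma>_pos borel_measurable_slab slab_bounds] by simp
qed

end

section \<open>The first-order lower bound\<close>

lemma classifiers_measurable [measurable_dest]: "f \<in> classifiers \<Longrightarrow> f \<in> borel_measurable borel"
  by (simp add: classifiers_def)

lemma classifier_component_measurable:
  "f \<in> classifiers \<Longrightarrow> (\<lambda>z. f z $ c) \<in> borel_measurable borel"
  unfolding classifiers_def
  by (auto intro!: borel_measurable_continuous_on[of "\<lambda>v. v $ c"] continuous_intros)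

lemma classifier_component_bounds:
  assumes "f \<in> classifiers"
  shows "0 \<le> f z $ c \<and> f z $ c \<le> 1"
proof -
  have "\<forall>i. 0 \<le> f z $ i" "(\<Sum>i\<in>UNIV. f z $ i) = 1"
    using assms by (auto simp: classifiers_def prob_simplex_def)
  then show ?thesis using member_le_sum[of c UNIV "\<lambda>i. f z $ i"] by simp
qed

definition two_class_classifier ::
  "'y \<Rightarrow> 'y \<Rightarrow> (real ^ 'd::finite \<Rightarrow> real) \<Rightarrow> real ^ 'd \<Rightarrow> real ^ 'y::finite" where
  "two_class_classifier c c' F z = F z *\<^sub>R axis c 1 + (1 - F z) *\<^sub>R axis c' 1"

lemma two_class_classifier_component: "c' \<noteq> c \<Longrightarrow> two_class_classifier c c' F z $ c = F z"
  by (simp add: two_class_classifier_def axis_def)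

lemma two_class_classifier_in_classifiers:
  assumes [measurable]: "F \<in> borel_measurable borel" and F: "\<And>z. 0 \<le> F z \<and> F z \<le> 1"
  shows "two_class_classifier c c' F \<in> classifiers"
proof -
  have "(\<Sum>i\<in>UNIV. two_class_classifier c c' F z $ i) = 1" for z
    by (simp add: two_class_classifier_def axis_def sum.distrib sum_distrib_left[symmetric])
  moreover have "0 \<le> two_class_classifier c c' F z $ i" for z i
    using F[of z] by (simp add: two_class_classifier_def axis_def)
  moreover have "two_class_classifier c c' F \<in> borel_measurable borel"
    unfolding two_class_classifier_def[abs_def] by measurable
  ultimately show ?thesis by (simp add: classifiers_def prob_simplex_def)
qed

context
  fixes \<sigma> :: real
  assumes \<sigma>_pos: "0 < \<sigma>"
begin

lemma smoothing_component:
  fixes f :: "real ^ 'd::finite \<Rightarrow> real ^ 'y::finite"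
  assumes f: "f \<in> classifiers"
  shows "smoothing f (gaussian_density \<sigma>) u $ c = (\<integral>z. f (u + z) $ c \<partial>gaussian_measure \<sigma>)"
proof -
  have [measurable]: "f \<in> borel_measurable borel" using f by (rule classifiers_measurable)
  interpret prob_space "gaussian_measure \<sigma> :: (real ^ 'd) measure"
    by (rule prob_space_gaussian[OF \<sigma>_pos])
  have "integrable (gaussian_measure \<sigma>) (\<lambda>z. f (u + z))"
  proof (rule integrable_const_bound[where B=1])
    have "norm (f z) \<le> 1" for z
    proof -
      have "norm (f z) \<le> (\<Sum>i\<in>UNIV. \<bar>f z $ i\<bar>)" by (rule norm_le_l1_cart)
      also have "\<dots> = (\<Sum>i\<in>UNIV. f z $ i)"
        using classifier_component_bounds[OF f] by (intro sum.cong) auto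
      also have "\<dots> = 1" using f by (simp add: classifiers_def prob_simplex_def)
      finally show ?thesis .
    qed
    then show "AE z in gaussian_measure \<sigma>. norm (f (u + z)) \<le> 1" by simp
  qed auto
  then have "(\<integral>z. f (u + z) $ c \<partial>gaussian_measure \<sigma>) = (\<integral>z. f (u + z) \<partial>gaussian_measure \<sigma>) $ c"
    by (intro integral_bounded_linear bounded_linear_vec_nth)
  also have "(\<integral>z. f (u + z) \<partial>gaussian_measure \<sigma>) = smoothing f (gaussian_density \<sigma>) u"
    unfolding gaussian_measure_def smoothing_def by (subst integral_density) auto
  finally show ?thesis ..
qed

definition first_order_tests :: "real \<Rightarrow> real ^ 'd::finite \<Rightarrow> (real ^ 'd \<Rightarrow> real) set" where
  "first_order_tests y0 y1 = test_functions (gaussian_measure \<sigma>)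
     (\<lambda>(a, v) z. a + z \<bullet> v) (\<lambda>(a, v). a * y0 + \<sigma>\<^sup>2 * (v \<bullet> y1))"

lemma first_order_tests_iff:
  fixes y1 :: "real ^ 'd::finite"
  shows "F \<in> first_order_tests y0 y1 \<longleftrightarrow> F \<in> borel_measurable borel \<and> (\<forall>z. 0 \<le> F z \<and> F z \<le> 1) \<and>
    (\<integral>z. F z \<partial>gaussian_measure \<sigma>) = y0 \<and>
    (\<forall>v. (\<integral>z. F z * (z \<bullet> v) \<partial>gaussian_measure \<sigma>) = \<sigma>\<^sup>2 * (v \<bullet> y1))"
proof -
  have "(\<forall>a v. (\<integral>z. F z * (a + z \<bullet> v) \<partial>gaussian_measure \<sigma>) = a * y0 + \<sigma>\<^sup>2 * (v \<bullet> y1)) \<longleftrightarrow>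
      (\<integral>z. F z \<partial>gaussian_measure \<sigma>) = y0 \<and>
      (\<forall>v. (\<integral>z. F z * (z \<bullet> v) \<partial>gaussian_measure \<sigma>) = \<sigma>\<^sup>2 * (v \<bullet> y1))" (is "?L \<longleftrightarrow> ?R")
    if F: "F \<in> borel_measurable borel" "\<forall>z. 0 \<le> F z \<and> F z \<le> 1"
  proof -
    interpret prob_space "gaussian_measure \<sigma> :: (real ^ 'd) measure"
      by (rule prob_space_gaussian[OF \<sigma>_pos])
    have i: "integrable (gaussian_measure \<sigma>) (\<lambda>z. F z * u z)" if "integrable (gaussian_measure \<sigma>) u" for u
      using integrable_mult_test[OF that, of F] F by (simp cong: measurable_cong_sets)
    have "(\<integral>z. F z * (a + z \<bullet> v) \<partial>gaussian_measure \<sigma>) =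
        a * (\<integral>z. F z \<partial>gaussian_measure \<sigma>) + (\<integral>z. F z * (z \<bullet> v) \<partial>gaussian_measure \<sigma>)" for a v
      using Bochner_Integration.integral_add[OF i[of "\<lambda>_. a"] i[OF integrable_inner[OF \<sigma>_pos, of v]]]
      by (simp add: distrib_left)
    then have *: "?L \<longleftrightarrow> (\<forall>a v. a * (\<integral>z. F z \<partial>gaussian_measure \<sigma>) +
        (\<integral>z. F z * (z \<bullet> v) \<partial>gaussian_measure \<sigma>) = a * y0 + \<sigma>\<^sup>2 * (v \<bullet> y1))" by simp
    show ?thesis
    proof
      assume ?L
      then have a: "a * (\<integral>z. F z \<partial>gaussian_measure \<sigma>) +
        (\<integral>z. F z * (z \<bullet> v) \<partial>gaussian_measure \<sigma>) = a * y0 + \<sigma>\<^sup>2 * (v \<bullet> y1)" for a v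
        using * by blast
      show ?R using a[of 1 0] a[of 0] by simp
    next
      assume ?R
      then show ?L unfolding * by simp
    qed
  qed
  then show ?thesis
    unfolding first_order_tests_def test_functions_def by (auto cong: measurable_cong_sets)
qed

lemma first_order_tests_attain_min:
  fixes y1 :: "real ^ 'd::finite"
  assumes "first_order_tests y0 y1 \<noteq> {}"
  shows "\<exists>F\<in>first_order_tests y0 y1. \<forall>G\<in>first_order_tests y0 y1.
    (\<integral>z. F z * tilt \<sigma> \<delta> z \<partial>gaussian_measure \<sigma>) \<le> (\<integral>z. G z * tilt \<sigma> \<delta> z \<partial>gaussian_measure \<sigma>)"
proof -
  interpret prob_space "gaussian_measure \<sigma> :: (real ^ 'd) measure"
    by (rule prob_space_gaussian[OF \<sigma>_pos])
  show ?thesis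
    using assms unfolding first_order_tests_def
    by (intro test_functions_attain_min)
       (auto intro!: integrable_inner integrable_tilt \<sigma>_pos)
qed

lemma classifier_test_iff:
  assumes f: "f \<in> classifiers"
  shows "(\<lambda>z. f (x + z) $ c) \<in> first_order_tests y0 y1 \<longleftrightarrow>
    smoothing f (gaussian_density \<sigma>) x $ c = y0 \<and>
    GDERIV (\<lambda>u. smoothing f (gaussian_density \<sigma>) u $ c) x :> y1"
proof -
  have m [measurable]: "(\<lambda>z. f z $ c) \<in> borel_measurable borel"
    by (rule classifier_component_measurable[OF f])
  have "(\<lambda>z. f (x + z) $ c) \<in> borel_measurable borel" by measurable
  then show ?thesis
    using classifier_component_bounds[OF f]
    by (simp add: smoothing_component[OF f] first_order_tests_iff
        gderiv_gaussian_smoothing_iff[OF \<sigma>_pos m classifier_component_bounds[OF f]])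
qed

lemma smoothing_component_shift:
  assumes f: "f \<in> classifiers"
  shows "smoothing f (gaussian_density \<sigma>) (x + \<delta>) $ c =
    (\<integral>z. f (x + z) $ c * tilt \<sigma> \<delta> z \<partial>gaussian_measure \<sigma>)"
proof -
  have [measurable]: "(\<lambda>z. f z $ c) \<in> borel_measurable borel"
    by (rule classifier_component_measurable[OF f])
  show ?thesis
    unfolding smoothing_component[OF f]
    using integral_gaussian_shift[of "\<lambda>z. f (x + z) $ c" \<sigma> \<delta>] by (simp add: add.assoc)
qed

lemma feasible_values_eq:
  fixes x \<delta> y1 :: "real ^ 'd::finite" and c :: "'y::finite"
  assumes "CARD('y) \<ge> 2"
  shows "{h (x + \<delta>) $ c | h :: real ^ 'd \<Rightarrow> real ^ 'y. h \<in> smoothed_classifiers (gaussian_density \<sigma>) \<and>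
      h x $ c = y0 \<and> GDERIV (\<lambda>u. h u $ c) x :> y1} =
    (\<lambda>F. \<integral>z. F z * tilt \<sigma> \<delta> z \<partial>gaussian_measure \<sigma>) ` first_order_tests y0 y1" (is "?A = ?B")
proof
  show "?A \<subseteq> ?B"
  proof
    fix v assume "v \<in> ?A"
    then obtain f :: "real ^ 'd \<Rightarrow> real ^ 'y" where f: "f \<in> classifiers"
      and v: "v = smoothing f (gaussian_density \<sigma>) (x + \<delta>) $ c"
      and "smoothing f (gaussian_density \<sigma>) x $ c = y0"
        "GDERIV (\<lambda>u. smoothing f (gaussian_density \<sigma>) u $ c) x :> y1"
      by (auto simp: smoothed_classifiers_def)
    then have "(\<lambda>z. f (x + z) $ c) \<in> first_order_tests y0 y1"
      by (simp add: classifier_test_iff)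
    then show "v \<in> ?B" unfolding v smoothing_component_shift[OF f] by (rule imageI)
  qed
  show "?B \<subseteq> ?A"
  proof
    fix v assume "v \<in> ?B"
    then obtain F where F: "F \<in> first_order_tests y0 y1" and v: "v = (\<integral>z. F z * tilt \<sigma> \<delta> z \<partial>gaussian_measure \<sigma>)"
      by blast
    have [measurable]: "F \<in> borel_measurable borel" and F01: "0 \<le> F z \<and> F z \<le> 1" for z
      using F by (auto simp: first_order_tests_iff)
    obtain c' where c': "c' \<noteq> c"
      using assms by (metis card_2_iff' ex_card)
    define f :: "real ^ 'd \<Rightarrow> real ^ 'y" where "f = two_class_classifier c c' (\<lambda>u. F (u - x))"
    have f: "f \<in> classifiers"
      unfolding f_def by (rule two_class_classifier_in_classifiers) (use F01 in auto)
    have eq: "(\<lambda>z. f (x + z) $ c) = F"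
      by (simp add: f_def two_class_classifier_component[OF c'])
    have "v = smoothing f (gaussian_density \<sigma>) (x + \<delta>) $ c"
      unfolding v smoothing_component_shift[OF f] by (simp add: fun_cong[OF eq])
    moreover have "smoothing f (gaussian_density \<sigma>) x $ c = y0"
        "GDERIV (\<lambda>u. smoothing f (gaussian_density \<sigma>) u $ c) x :> y1"
      using F classifier_test_iff[OF f, of x c y0 y1] by (simp_all add: eq)
    ultimately show "v \<in> ?A"
      using f unfolding smoothed_classifiers_def by blast
  qed
qed

lemma lower_bound_prob_eq:
  fixes x \<delta> y1 :: "real ^ 'd::finite" and c :: "'y::finite"
  assumes "CARD('y) \<ge> 2" and ne: "first_order_tests y0 y1 \<noteq> {}"
  obtains F where "F \<in> first_order_tests y0 y1"
    "lower_bound_prob (gaussian_density \<sigma>) c x y0 y1 (x + \<delta>) = (\<integral>z. F z * tilt \<sigma> \<delta> z \<partial>gaussian_measure \<sigma>)"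
    "\<And>G. G \<in> first_order_tests y0 y1 \<Longrightarrow>
      lower_bound_prob (gaussian_density \<sigma>) c x y0 y1 (x + \<delta>) \<le> (\<integral>z. G z * tilt \<sigma> \<delta> z \<partial>gaussian_measure \<sigma>)"
proof -
  obtain F where F: "F \<in> first_order_tests y0 y1" and min: "\<forall>G\<in>first_order_tests y0 y1.
    (\<integral>z. F z * tilt \<sigma> \<delta> z \<partial>gaussian_measure \<sigma>) \<le> (\<integral>z. G z * tilt \<sigma> \<delta> z \<partial>gaussian_measure \<sigma>)"
    using first_order_tests_attain_min[OF ne, of \<delta>] by blast
  have "lower_bound_prob (gaussian_density \<sigma>) c x y0 y1 (x + \<delta>) = (\<integral>z. F z * tilt \<sigma> \<delta> z \<partial>gaussian_measure \<sigma>)"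
    unfolding lower_bound_prob_def feasible_values_eq[OF assms(1)]
    using F min by (intro Least_equality) auto
  then show ?thesis using that F min by simp
qed

lemma first_order_test_lower_bound:
  fixes k :: "real ^ 'd::finite"
  assumes F: "F \<in> first_order_tests y0 y1" and k: "norm k = 1 / \<sigma>" and "0 \<le> s"
    and w: "w2 < ereal w1" "w2 \<le> 0" "0 \<le> w1"
    and q: "Phi (ereal w1) - Phi w2 \<le> y0" and m: "\<sigma> * norm y1 \<le> phi (ereal w1) - phi w2"
  shows "Phi (ereal w1 - ereal s) - Phi (w2 - ereal s) \<le>
    (\<integral>z. F z * tilt \<sigma> ((s * \<sigma>\<^sup>2) *\<^sub>R k) z \<partial>gaussian_measure \<sigma>)"
proof -
  let ?N = "gaussian_measure \<sigma> :: (real ^ 'd) measure"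
  let ?d = "(s * \<sigma>\<^sup>2) *\<^sub>R k"
  let ?H = "slab w2 w1 k"
  interpret prob_space ?N by (rule prob_space_gaussian[OF \<sigma>_pos])
  obtain a b where ab: "0 \<le> a" "0 \<le> b"
    and inside: "\<And>t. w2 < ereal t \<Longrightarrow> t \<le> w1 \<Longrightarrow> exp (s * t - s\<^sup>2 / 2) \<le> a + b * t"
    and outside: "\<And>t. ereal t \<le> w2 \<or> w1 < t \<Longrightarrow> a + b * t \<le> exp (s * t - s\<^sup>2 / 2)"
    using exp_chord[OF \<open>0 \<le> s\<close> w(2) w(1) w(3)] by metis
  have [measurable]: "F \<in> borel_measurable borel" and F0: "(\<integral>z. F z \<partial>?N) = y0"
    using F by (auto simp: first_order_tests_iff)
  have F01: "0 \<le> F z \<and> F z \<le> 1" and F1: "(\<integral>z. F z * (z \<bullet> v) \<partial>?N) = \<sigma>\<^sup>2 * (v \<bullet> y1)" for z v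
    using F by (auto simp: first_order_tests_iff)
  have tilt: "tilt \<sigma> ?d z = exp (s * (z \<bullet> k) - s\<^sup>2 / 2)" for z
  proof -
    have "(norm ?d)\<^sup>2 / (2 * \<sigma>\<^sup>2) = s\<^sup>2 / 2"
      using k \<sigma>_pos by (simp add: power_mult_distrib power_divide power2_eq_square)
    moreover have "z \<bullet> ?d / \<sigma>\<^sup>2 = s * (z \<bullet> k)" using \<sigma>_pos by simp
    ultimately show ?thesis by (simp add: tilt_def)
  qed
  have pointwise: "0 \<le> (F z - ?H z) * (tilt \<sigma> ?d z - (a + b * (z \<bullet> k)))" for z
  proof (cases "w2 < ereal (z \<bullet> k) \<and> z \<bullet> k \<le> w1")
    case True
    then show ?thesis
      unfolding tilt using F01[of z] inside[of "z \<bullet> k"] by (intro mult_nonpos_nonpos) (auto simp: slab_def)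
  next
    case False
    then have "ereal (z \<bullet> k) \<le> w2 \<or> w1 < z \<bullet> k" by auto
    then show ?thesis
      unfolding tilt using False F01[of z] outside[of "z \<bullet> k"]
      by (intro mult_nonneg_nonneg) (auto simp: slab_def)
  qed
  have iF: "integrable ?N (\<lambda>z. F z * u z)" and iH: "integrable ?N (\<lambda>z. ?H z * u z)"
    if "integrable ?N u" for u
    by (rule integrable_mult_test[OF that _ F01], measurable)
       (rule integrable_mult_test[OF that _ slab_bounds], measurable)
  have int: "(\<integral>z. G z * (tilt \<sigma> ?d z - (a + b * (z \<bullet> k))) \<partial>?N) =
      (\<integral>z. G z * tilt \<sigma> ?d z \<partial>?N) - (a * (\<integral>z. G z \<partial>?N) + b * (\<integral>z. G z * (z \<bullet> k) \<partial>?N))"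
    if i: "\<And>u. integrable ?N u \<Longrightarrow> integrable ?N (\<lambda>z. G z * u z)" for G :: "real ^ 'd \<Rightarrow> real"
  proof -
    have i1: "integrable ?N (\<lambda>z. G z * tilt \<sigma> ?d z)" by (intro i integrable_tilt \<sigma>_pos)
    have i2: "integrable ?N (\<lambda>z. a * G z)" using i[of "\<lambda>_. a"] by (simp add: mult.commute)
    have i3: "integrable ?N (\<lambda>z. b * (G z * (z \<bullet> k)))"
      by (intro integrable_mult_right i integrable_inner \<sigma>_pos)
    have "(\<integral>z. G z * (tilt \<sigma> ?d z - (a + b * (z \<bullet> k))) \<partial>?N) =
        (\<integral>z. G z * tilt \<sigma> ?d z - (a * G z + b * (G z * (z \<bullet> k))) \<partial>?N)"
      by (intro Bochner_Integration.integral_cong) (auto simp: algebra_simps)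
    also have "\<dots> = (\<integral>z. G z * tilt \<sigma> ?d z \<partial>?N) - ((\<integral>z. a * G z \<partial>?N) + (\<integral>z. b * (G z * (z \<bullet> k)) \<partial>?N))"
      unfolding Bochner_Integration.integral_diff[OF i1 Bochner_Integration.integrable_add[OF i2 i3]]
        Bochner_Integration.integral_add[OF i2 i3] ..
    finally show ?thesis by simp
  qed
  have iw: "integrable ?N (\<lambda>z. tilt \<sigma> ?d z - (a + b * (z \<bullet> k)))"
    by (intro Bochner_Integration.integrable_diff Bochner_Integration.integrable_add
        integrable_mult_right integrable_tilt integrable_inner \<sigma>_pos) auto
  have "0 \<le> (\<integral>z. (F z - ?H z) * (tilt \<sigma> ?d z - (a + b * (z \<bullet> k))) \<partial>?N)"
    using pointwise by (intro integral_nonneg_AE) auto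
  also have "\<dots> = (\<integral>z. F z * (tilt \<sigma> ?d z - (a + b * (z \<bullet> k))) \<partial>?N) -
      (\<integral>z. ?H z * (tilt \<sigma> ?d z - (a + b * (z \<bullet> k))) \<partial>?N)"
    unfolding left_diff_distrib by (rule Bochner_Integration.integral_diff[OF iF[OF iw] iH[OF iw]])
  also have "\<dots> = (\<integral>z. F z * tilt \<sigma> ?d z \<partial>?N) - (\<integral>z. ?H z * tilt \<sigma> ?d z \<partial>?N)
      - a * (y0 - (\<integral>z. ?H z \<partial>?N)) - b * (\<sigma>\<^sup>2 * (k \<bullet> y1) - (\<integral>z. ?H z * (z \<bullet> k) \<partial>?N))"
    by (subst int, erule iF, subst int, erule iH, unfold F0 F1, algebra)
  finally have *: "(\<integral>z. ?H z * tilt \<sigma> ?d z \<partial>?N) + a * (y0 - (\<integral>z. ?H z \<partial>?N)) +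
      b * (\<sigma>\<^sup>2 * (k \<bullet> y1) - (\<integral>z. ?H z * (z \<bullet> k) \<partial>?N)) \<le> (\<integral>z. F z * tilt \<sigma> ?d z \<partial>?N)"
    by simp
  have "0 \<le> a * (y0 - (\<integral>z. ?H z \<partial>?N))"
    unfolding integral_slab[OF \<sigma>_pos k w(1)] using ab q by simp
  moreover have "0 \<le> b * (\<sigma>\<^sup>2 * (k \<bullet> y1) - (\<integral>z. ?H z * (z \<bullet> k) \<partial>?N))"
  proof -
    have kk: "\<sigma>\<^sup>2 * (k \<bullet> k) = 1"
      using k \<sigma>_pos by (simp add: power2_norm_eq_inner[symmetric] power_divide)
    have "- (norm k * norm y1) \<le> k \<bullet> y1"
      using Cauchy_Schwarz_ineq2[of k y1] by linarith
    then have "\<sigma>\<^sup>2 * (- (norm k * norm y1)) \<le> \<sigma>\<^sup>2 * (k \<bullet> y1)"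
      by (intro mult_left_mono) auto
    also have "\<sigma>\<^sup>2 * (- (norm k * norm y1)) = - (\<sigma> * norm y1)"
      using k \<sigma>_pos by (simp add: power2_eq_square)
    finally have "phi w2 - phi (ereal w1) \<le> \<sigma>\<^sup>2 * (k \<bullet> y1)" using m by linarith
    moreover have "\<sigma>\<^sup>2 * (phi w2 - phi (ereal w1)) * (k \<bullet> k) = phi w2 - phi (ereal w1)"
      using kk by (metis mult.assoc mult.commute mult.right_neutral)
    ultimately have "\<sigma>\<^sup>2 * (phi w2 - phi (ereal w1)) * (k \<bullet> k) \<le> \<sigma>\<^sup>2 * (k \<bullet> y1)" by linarith
    then show ?thesis
      unfolding integral_slab_inner[OF \<sigma>_pos k w(1)] using ab(2) by (intro mult_nonneg_nonneg) linarith+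
  qed
  ultimately show ?thesis
    using * unfolding integral_slab_tilt[OF \<sigma>_pos k w(1)] by linarith
qed

end

theorem corollary3p1:
  fixes \<sigma> :: real
    and f :: "real ^ 'd::finite \<Rightarrow> real ^ 'y::finite"
    and c :: 'y
    and x y1 :: "real ^ 'd::finite"
    and y0 q m1 r w1 :: real
    and w2 :: ereal
  assumes "CARD('y) \<ge> 2"
    and "\<sigma> > 0"
    and "f \<in> classifiers"
    and "y0 = smoothing f (gaussian_density \<sigma>) x $ c"
    and "GDERIV (\<lambda>u. smoothing f (gaussian_density \<sigma>) u $ c) x :> y1"
    and "1 / 2 < q" and "q \<le> y0"
    and "m1 \<ge> \<sigma> * norm y1"
    and "r > 0"
    and "w2 < ereal w1"
    and "Phi (ereal w1 - ereal r) - Phi (w2 - ereal r) = 1 / 2"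
    and "Phi (ereal w1) - Phi w2 = q"
    and "phi (ereal w1) - phi w2 = m1"
  shows "certified_radius (safety_region (gaussian_density \<sigma>) c x y0 y1) (\<sigma> * r)
    \<and> (q = y0 \<and> m1 = \<sigma> * norm y1 \<longrightarrow>
        (\<forall>\<rho>. certified_radius (safety_region (gaussian_density \<sigma>) c x y0 y1) \<rho> \<longrightarrow> \<rho> \<le> \<sigma> * r))"
proof -
  note w = \<open>w2 < ereal w1\<close>
  have "(\<lambda>z. f (x + z) $ c) \<in> first_order_tests \<sigma> y0 y1"
    using assms(4,5) by (simp add: classifier_test_iff[OF assms(2,3)])
  then have ne: "first_order_tests \<sigma> y0 y1 \<noteq> {}" by blast
  have "0 \<le> m1" using assms(8) mult_nonneg_nonneg[OF less_imp_le[OF assms(2)] norm_ge_zero[of y1]] by linarith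
  then have phi_le: "phi w2 \<le> phi (ereal w1)" using assms(13) by linarith
  have "0 < w1"
  proof (rule ccontr)
    assume "\<not> 0 < w1"
    then have "Phi (ereal w1) \<le> 1 / 2" using cdf_std_normal_le_half[of w1] by simp
    moreover have "0 \<le> Phi w2"
      using w by (cases w2) (auto simp: cdf_def)
    ultimately show False using assms(6,12) by linarith
  qed
  have "w2 \<le> 0"
  proof (cases w2)
    case (real v)
    then have "w1\<^sup>2 \<le> v\<^sup>2" "v < w1"
      using phi_le w by (auto simp: phi_real std_normal_density_le_iff)
    then have "v \<le> 0" using power_strict_mono[of v w1 2] by fastforce
    then show ?thesis using real by simp
  qed (use w in auto)
  have lower: "Phi (ereal w1 - ereal s) - Phi (w2 - ereal s) \<le>
      lower_bound_prob (gaussian_density \<sigma>) c x y0 y1 (x + (s * \<sigma>\<^sup>2) *\<^sub>R k)"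
    if "norm k = 1 / \<sigma>" "0 \<le> s" for k s
  proof -
    obtain F where "F \<in> first_order_tests \<sigma> y0 y1"
      "lower_bound_prob (gaussian_density \<sigma>) c x y0 y1 (x + (s * \<sigma>\<^sup>2) *\<^sub>R k) =
        (\<integral>z. F z * tilt \<sigma> ((s * \<sigma>\<^sup>2) *\<^sub>R k) z \<partial>gaussian_measure \<sigma>)"
      using lower_bound_prob_eq[OF assms(2,1) ne, of c x "(s * \<sigma>\<^sup>2) *\<^sub>R k"] by blast
    then show ?thesis
      using first_order_test_lower_bound[OF assms(2) _ that w \<open>w2 \<le> 0\<close>, of F y0 y1]
        \<open>0 < w1\<close> assms(7,8,12,13) by simp
  qed
  have "certified_radius (safety_region (gaussian_density \<sigma>) c x y0 y1) (\<sigma> * r)"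
    unfolding certified_radius_def safety_region_def mem_Collect_eq
  proof (intro allI impI)
    fix \<delta> :: "real ^ 'd" assume \<delta>: "norm \<delta> < \<sigma> * r"
    define s where "s = norm \<delta> / \<sigma>"
    obtain k where k: "norm k = 1 / \<sigma>" "\<delta> = (s * \<sigma>\<^sup>2) *\<^sub>R k"
    proof (cases "\<delta> = 0")
      case True
      obtain k :: "real ^ 'd" where "norm k = 1 / \<sigma>"
        using vector_choose_size[of "1 / \<sigma>"] \<open>\<sigma> > 0\<close> by auto
      then show ?thesis using that True by (simp add: s_def)
    next
      case False
      show ?thesis
        by (rule that[of "\<delta> /\<^sub>R (\<sigma> * norm \<delta>)"])
           (use False \<open>\<sigma> > 0\<close> in \<open>auto simp: s_def power2_eq_square divide_simps\<close>)
    qed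
    have s: "0 \<le> s" "s < r"
      using \<delta> \<open>\<sigma> > 0\<close> by (auto simp: s_def pos_divide_less_eq mult.commute)
    have "1 / 2 < Phi (ereal w1 - ereal s) - Phi (w2 - ereal s)"
      using Phi_diff_strict_decreasing[OF w phi_le s] assms(11) by simp
    also have "\<dots> \<le> lower_bound_prob (gaussian_density \<sigma>) c x y0 y1 (x + \<delta>)"
      using lower[OF k(1) s(1)] k(2) by simp
    finally show "1 / 2 < lower_bound_prob (gaussian_density \<sigma>) c x y0 y1 (x + \<delta>)" .
  qed
  moreover have "\<rho> \<le> \<sigma> * r"
    if eq: "q = y0" "m1 = \<sigma> * norm y1"
      and \<rho>: "certified_radius (safety_region (gaussian_density \<sigma>) c x y0 y1) \<rho>" for \<rho>
  proof (rule ccontr)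
    assume "\<not> \<rho> \<le> \<sigma> * r"
    obtain k where k: "norm k = 1 / \<sigma>" "- (\<sigma> * norm y1) *\<^sub>R k = y1"
    proof (cases "y1 = 0")
      case True
      obtain k :: "real ^ 'd" where "norm k = 1 / \<sigma>"
        using vector_choose_size[of "1 / \<sigma>"] \<open>\<sigma> > 0\<close> by auto
      then show ?thesis using that True by simp
    next
      case False
      show ?thesis
        by (rule that[of "- (y1 /\<^sub>R (\<sigma> * norm y1))"])
           (use False \<open>\<sigma> > 0\<close> in \<open>auto simp: divide_simps\<close>)
    qed
    define \<delta> where "\<delta> = (r * \<sigma>\<^sup>2) *\<^sub>R k"
    have "norm \<delta> = \<sigma> * r"
      using k(1) \<open>\<sigma> > 0\<close> \<open>r > 0\<close> by (simp add: \<delta>_def power2_eq_square)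
    then have "\<delta> \<in> safety_region (gaussian_density \<sigma>) c x y0 y1"
      using \<rho> \<open>\<not> \<rho> \<le> \<sigma> * r\<close> by (simp add: certified_radius_def)
    then have "1 / 2 < lower_bound_prob (gaussian_density \<sigma>) c x y0 y1 (x + \<delta>)"
      by (simp add: safety_region_def)
    also have "\<dots> \<le> (\<integral>z. slab w2 w1 k z * tilt \<sigma> \<delta> z \<partial>gaussian_measure \<sigma>)"
    proof -
      have "\<sigma>\<^sup>2 * (phi w2 - phi (ereal w1)) * (v \<bullet> k) = \<sigma>\<^sup>2 * (v \<bullet> y1)" for v
      proof -
        have "v \<bullet> y1 = - (\<sigma> * norm y1) * (v \<bullet> k)"
          using k(2) by (metis inner_scaleR_right)
        also have "- (\<sigma> * norm y1) = phi w2 - phi (ereal w1)" using assms(13) eq by simp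
        finally show ?thesis by simp
      qed
      then have "slab w2 w1 k \<in> first_order_tests \<sigma> y0 y1"
        using assms(12) eq slab_bounds[of w2 w1 k]
        by (simp add: first_order_tests_iff[OF assms(2)] integral_slab[OF assms(2) k(1) w]
            integral_slab_inner[OF assms(2) k(1) w])
      then show ?thesis
        using lower_bound_prob_eq[OF assms(2,1) ne, of c x \<delta>] by blast
    qed
    also have "\<dots> = 1 / 2"
      unfolding \<delta>_def integral_slab_tilt[OF assms(2) k(1) w] by (rule assms(11))
    finally show False by simp
  qed
  ultimately show ?thesis by blast
qed

end
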